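(* (Weierstrass representation.) We can construct a semi-discrete minimal surface $x$ from a semi-discrete holomorphic function $g$ by solving $$\partial x=-\frac{\tau}{2}\,\mathrm{Re}\begin{pmatrix}\frac{1-g^2}{g'}\\[2pt] \frac{\mathrm{i}(1+g^2)}{g'}\\[2pt] \frac{2g}{g'}\end{pmatrix},\qquad \Delta x=\frac{\sigma}{2}\,\mathrm{Re}\begin{pmatrix}\frac{1-gg_1}{\Delta g}\\[2pt] \frac{\mathrm{i}(1+gg_1)}{\Delta g}\\[2pt] \frac{g+g_1}{\Delta g}\end{pmatrix},$$ where $\tau$ and $\sigma$ are the functions appearing in the definition of isothermic, applied to $g$. Conversely, any semi-discrete minimal surface $x$ is described in this way by some semi-discrete holomorphic function $g$.
   Context: A semi-discrete surface is a map $x=x(k,t)$ from a domain in $\mathbb{Z}\times\mathbb{R}$ to $\mathbb{R}^3$ ($k\in\mathbb{Z}$, $t\in\mathbb{R}$). Write $x_1=x(k+1,t)$ (similarly for other functions of $(k,t)$), $\partial x=\partial x/\partial t$, $\Delta x=x_1-x$, $\partial\Delta x=\partial x_1-\partial x$. - $x$ is conjugate if $\partial x$, $\Delta x$ and $\partial\Delta x$ are linearly dependent. - $x$ is circular if, for all $k,t$, there exists a circle passing through $x$ and $x_1$ that is tangent to $\partial x$, $\partial x_1$ there. If $x$ lies in $\mathbb{R}^2\cong\mathbb{C}$, circularity is taken to be equivalent to the existence of a function $s$ with values in $\mathbb{R}\setminus\{0\}$ such that $\Delta x=\mathrm{i}s\left(\frac{\partial x}{\|\partial x\|}+\frac{\partial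 x_1}{\|\partial x_1\|}\right)$. - Conjugate semi-discrete surfaces $x$, $x^*$ are dual if there exists a positive function $\nu$ of $(k,t)$ such that $\partial x^*=-\frac{1}{\nu^2}\partial x$ and $\Delta x^*=\frac{1}{\nu\nu_1}\Delta x$. - A circular semi-discrete surface $x$ is isothermic if there exist positive functions $\nu,\sigma,\tau$ such that $\|\Delta x\|^2=\sigma\nu\nu_1$, $\|\partial x\|^2=\tau\nu^2$, with $\partial\sigma=\Delta\tau=0$. The function $\nu$ here is the same as the $\nu$ in the definition of the dual surface $x^*$ of $x$. - A semi-discrete isothermic surface $x$ is (semi-discrete) minimal if its dual $x^*$ is inscribed in a sphere. - A semi-discrete holomorphic function is a semi-discrete isothermic surface $g$ that lies in a plane, the plane being identified with $\mathbb{C}$; one writes $g'=\partial g$, $g_1=g(k+1,t)$, $\Delta g=g_1-g$.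
   Formalization: Existence of x is claimed when each slice of the domain is an interval; in the converse, the dual must miss the north pole of its sphere (else x is first rotated), and g may have straight-line circles (s infinite) unless the dual's edge circles also miss the pole. *)

theory Defs
  imports "HOL-Analysis.Analysis"
begin

text \<open>A semi-discrete surface is a function of \<open>k :: int\<close> and \<open>t :: real\<close>, considered on an open set
  \<open>D :: (int \<times> real) set\<close>. As \<^typ>\<open>int\<close> is discrete, \<open>open D\<close> says that every slice is open in the reals.
  Connectedness of \<open>D\<close> is never needed.\<close>

definition slice :: "(int \<times> real) set \<Rightarrow> int \<Rightarrow> real set" where
  "slice D k = {t. (k, t) \<in> D}"

definition edges :: "(int \<times> real) set \<Rightarrow> (int \<times> real) set" where
  "edges D = {(k, t). (k, t) \<in> D \<and> (k + 1, t) \<in> D}"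

definition pd :: "(int \<Rightarrow> real \<Rightarrow> 'a::real_normed_vector) \<Rightarrow> int \<Rightarrow> real \<Rightarrow> 'a" where
  "pd x k t = vector_derivative (x k) (at t)"

definition diff :: "(int \<Rightarrow> real \<Rightarrow> 'a::real_normed_vector) \<Rightarrow> int \<Rightarrow> real \<Rightarrow> 'a" where
  "diff x k t = x (k + 1) t - x k t"

definition sd_surface :: "(int \<times> real) set \<Rightarrow> (int \<Rightarrow> real \<Rightarrow> 'a::real_normed_vector) \<Rightarrow> bool" where
  "sd_surface D x \<longleftrightarrow>
     (\<forall>(k, t) \<in> D. x k differentiable (at t)) \<and>
     (\<forall>k. continuous_on (slice D k) (pd x k))"

text \<open>Linear dependence of the family (not of the set) of the three vectors.\<close>

definition conjugate :: "(int \<times> real) set \<Rightarrow> (int \<Rightarrow> real \<Rightarrow> real^3) \<Rightarrow> bool" where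
  "conjugate D x \<longleftrightarrow>
     (\<forall>(k, t) \<in> edges D. \<exists>a b c. (a, b, c) \<noteq> (0, 0, 0) \<and>
        a *\<^sub>R pd x k t + b *\<^sub>R diff x k t + c *\<^sub>R diff (pd x) k t = 0)"

text \<open>The circle with centre \<open>m\<close> and radius \<open>r\<close> in the plane through \<open>m\<close> with normal \<open>n\<close>.\<close>

definition circle3 :: "real^3 \<Rightarrow> real^3 \<Rightarrow> real \<Rightarrow> (real^3) set" where
  "circle3 m n r = {p. dist p m = r \<and> n \<bullet> (p - m) = 0}"

definition tangent_to_circle3 :: "real^3 \<Rightarrow> real^3 \<Rightarrow> real \<Rightarrow> real^3 \<Rightarrow> real^3 \<Rightarrow> bool" where
  "tangent_to_circle3 m n r p v \<longleftrightarrow> p \<in> circle3 m n r \<and> n \<bullet> v = 0 \<and> (p - m) \<bullet> v = 0"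

definition edge_circle ::
    "(int \<Rightarrow> real \<Rightarrow> real^3) \<Rightarrow> int \<Rightarrow> real \<Rightarrow> real^3 \<Rightarrow> real^3 \<Rightarrow> real \<Rightarrow> bool" where
  "edge_circle x k t m n r \<longleftrightarrow> r > 0 \<and> n \<noteq> 0 \<and>
     tangent_to_circle3 m n r (x k t) (pd x k t) \<and>
     tangent_to_circle3 m n r (x (k + 1) t) (pd x (k + 1) t)"

definition circular :: "(int \<times> real) set \<Rightarrow> (int \<Rightarrow> real \<Rightarrow> real^3) \<Rightarrow> bool" where
  "circular D x \<longleftrightarrow> (\<forall>(k, t) \<in> edges D. \<exists>m n r. edge_circle x k t m n r)"

definition dual ::
    "(int \<times> real) set \<Rightarrow> (int \<Rightarrow> real \<Rightarrow> real) \<Rightarrow>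
     (int \<Rightarrow> real \<Rightarrow> real^3) \<Rightarrow> (int \<Rightarrow> real \<Rightarrow> real^3) \<Rightarrow> bool" where
  "dual D \<nu> x y \<longleftrightarrow>
     sd_surface D x \<and> sd_surface D y \<and> conjugate D x \<and> conjugate D y \<and>
     (\<forall>(k, t) \<in> D. \<nu> k t > 0 \<and> pd y k t = - (1 / (\<nu> k t)\<^sup>2) *\<^sub>R pd x k t) \<and>
     (\<forall>(k, t) \<in> edges D. diff y k t = (1 / (\<nu> k t * \<nu> (k + 1) t)) *\<^sub>R diff x k t)"

text \<open>The metric part of the isothermic condition. \<open>\<sigma>\<close> belongs to the edge from \<open>(k, t)\<close> to \<open>(k + 1, t)\<close>,
  so it is only constrained on \<open>edges D\<close>. Continuity of \<open>\<nu>\<close> (and hence of \<open>\<tau>\<close>) has to be required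
  only for the sake of points of \<open>D\<close> which are on no edge.\<close>

definition isothermic_metric ::
    "(int \<times> real) set \<Rightarrow> (int \<Rightarrow> real \<Rightarrow> 'a::real_normed_vector) \<Rightarrow>
     (int \<Rightarrow> real \<Rightarrow> real) \<Rightarrow> (int \<Rightarrow> real \<Rightarrow> real) \<Rightarrow> (int \<Rightarrow> real \<Rightarrow> real) \<Rightarrow> bool" where
  "isothermic_metric D x \<nu> \<sigma> \<tau> \<longleftrightarrow>
     (\<forall>k. continuous_on (slice D k) (\<nu> k)) \<and>
     (\<forall>(k, t) \<in> D. \<nu> k t > 0 \<and> \<tau> k t > 0 \<and> (norm (pd x k t))\<^sup>2 = \<tau> k t * (\<nu> k t)\<^sup>2) \<and>
     (\<forall>(k, t) \<in> edges D. \<sigma> k t > 0 \<and> (norm (diff x k t))\<^sup>2 = \<sigma> k t * \<nu> k t * \<nu> (k + 1) t \<and>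
        (\<sigma> k has_real_derivative 0) (at t) \<and> diff \<tau> k t = 0)"

definition isothermic ::
    "(int \<times> real) set \<Rightarrow> (int \<Rightarrow> real \<Rightarrow> real^3) \<Rightarrow>
     (int \<Rightarrow> real \<Rightarrow> real) \<Rightarrow> (int \<Rightarrow> real \<Rightarrow> real) \<Rightarrow> (int \<Rightarrow> real \<Rightarrow> real) \<Rightarrow> bool" where
  "isothermic D x \<nu> \<sigma> \<tau> \<longleftrightarrow>
     sd_surface D x \<and> circular D x \<and> isothermic_metric D x \<nu> \<sigma> \<tau>"

definition minimal_with_dual ::
    "(int \<times> real) set \<Rightarrow> (int \<Rightarrow> real \<Rightarrow> real^3) \<Rightarrow> (int \<Rightarrow> real \<Rightarrow> real^3) \<Rightarrow>
     real^3 \<Rightarrow> real \<Rightarrow> bool" where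
  "minimal_with_dual D x y c r \<longleftrightarrow>
     (\<exists>\<nu> \<sigma> \<tau>. isothermic D x \<nu> \<sigma> \<tau> \<and> dual D \<nu> x y) \<and>
     r > 0 \<and> (\<forall>(k, t) \<in> D. y k t \<in> sphere c r)"

definition sd_minimal :: "(int \<times> real) set \<Rightarrow> (int \<Rightarrow> real \<Rightarrow> real^3) \<Rightarrow> bool" where
  "sd_minimal D x \<longleftrightarrow> (\<exists>y c r. minimal_with_dual D x y c r)"

text \<open>Circularity in the complex plane. The factor \<open>\<i>\<close> fixes the orientation: along the circle the
  two derivatives point in opposite directions.\<close>

definition planar_circular_edge :: "(int \<Rightarrow> real \<Rightarrow> complex) \<Rightarrow> int \<Rightarrow> real \<Rightarrow> bool" where
  "planar_circular_edge g k t \<longleftrightarrow>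
     (\<exists>s::real. s \<noteq> 0 \<and>
        diff g k t = \<i> * of_real s * (sgn (pd g k t) + sgn (pd g (k + 1) t)))"

text \<open>The limiting case \<open>s = \<infinity>\<close>, where the circle is a straight line. It arises when a circle on the
  sphere passes through the centre of the stereographic projection.\<close>

definition planar_straight_edge :: "(int \<Rightarrow> real \<Rightarrow> complex) \<Rightarrow> int \<Rightarrow> real \<Rightarrow> bool" where
  "planar_straight_edge g k t \<longleftrightarrow>
     sgn (pd g k t) + sgn (pd g (k + 1) t) = 0 \<and>
     (\<exists>s::real. s \<noteq> 0 \<and> diff g k t = of_real s * sgn (pd g k t))"

definition sd_holomorphic ::
    "(int \<times> real) set \<Rightarrow> (int \<Rightarrow> real \<Rightarrow> complex) \<Rightarrow>
     (int \<Rightarrow> real \<Rightarrow> real) \<Rightarrow> (int \<Rightarrow> real \<Rightarrow> real) \<Rightarrow> (int \<Rightarrow> real \<Rightarrow> real) \<Rightarrow> bool" where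
  "sd_holomorphic D g \<nu> \<sigma> \<tau> \<longleftrightarrow>
     sd_surface D g \<and> (\<forall>(k, t) \<in> edges D. planar_circular_edge g k t) \<and>
     isothermic_metric D g \<nu> \<sigma> \<tau>"

definition sd_holomorphic_or_straight ::
    "(int \<times> real) set \<Rightarrow> (int \<Rightarrow> real \<Rightarrow> complex) \<Rightarrow>
     (int \<Rightarrow> real \<Rightarrow> real) \<Rightarrow> (int \<Rightarrow> real \<Rightarrow> real) \<Rightarrow> (int \<Rightarrow> real \<Rightarrow> real) \<Rightarrow> bool" where
  "sd_holomorphic_or_straight D g \<nu> \<sigma> \<tau> \<longleftrightarrow>
     sd_surface D g \<and>
     (\<forall>(k, t) \<in> edges D. planar_circular_edge g k t \<or> planar_straight_edge g k t) \<and>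
     isothermic_metric D g \<nu> \<sigma> \<tau>"

text \<open>For isothermic \<open>g\<close> the denominators \<open>pd g\<close> and \<open>diff g\<close> do not vanish.\<close>

definition weierstrass ::
    "(int \<times> real) set \<Rightarrow> (int \<Rightarrow> real \<Rightarrow> complex) \<Rightarrow>
     (int \<Rightarrow> real \<Rightarrow> real) \<Rightarrow> (int \<Rightarrow> real \<Rightarrow> real) \<Rightarrow> (int \<Rightarrow> real \<Rightarrow> real^3) \<Rightarrow> bool" where
  "weierstrass D g \<sigma> \<tau> x \<longleftrightarrow>
     sd_surface D x \<and>
     (\<forall>(k, t) \<in> D. pd x k t = - (\<tau> k t / 2) *\<^sub>R
        vector [Re ((1 - (g k t)\<^sup>2) / pd g k t),
                Re (\<i> * (1 + (g k t)\<^sup>2) / pd g k t),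
                Re (2 * g k t / pd g k t)]) \<and>
     (\<forall>(k, t) \<in> edges D. diff x k t = (\<sigma> k t / 2) *\<^sub>R
        vector [Re ((1 - g k t * g (k + 1) t) / diff g k t),
                Re (\<i> * (1 + g k t * g (k + 1) t) / diff g k t),
                Re ((g k t + g (k + 1) t) / diff g k t)])"

text \<open>The north pole of the sphere with centre \<open>c\<close> and radius \<open>r\<close>: the centre of the stereographic
  projection that takes the dual surface to \<open>g\<close>.\<close>

definition north_pole :: "real^3 \<Rightarrow> real \<Rightarrow> real^3" where
  "north_pole c r = c + r *\<^sub>R vector [0, 0, 1]"

end

theory Submission
  imports Defs
begin

text \<open>
  Write \<open>n\<close> for the inverse of the stereographic projection of the unit sphere. The Weierstrass
  integrands are, up to positive factors, the derivative and the difference of \<open>n \<circ> g\<close>: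
  for the vector \<open>W g h p = Re (p * (1 - g h, \<i> (1 + g h), g + h))\<close> one has
  \<open>(n \<circ> g)' = 2 / (1 + \<bar>g\<bar>\<^sup>2)\<^sup>2 W g g (cnj g')\<close> and
  \<open>n h - n g = 2 / ((1 + \<bar>g\<bar>\<^sup>2) (1 + \<bar>h\<bar>\<^sup>2)) W g h (cnj (h - g))\<close>.
  Since \<open>1 / g' = cnj g' / \<bar>g'\<bar>\<^sup>2\<close> and \<open>\<bar>g'\<bar>\<^sup>2 = \<tau> \<nu>\<^sup>2\<close>, and likewise for differences, the two Weierstrass
  equations say exactly that \<open>x\<close> is dual to \<open>n \<circ> g\<close> with metric factor \<open>(1 + \<bar>g\<bar>\<^sup>2) / (2 \<nu>)\<close>.

  It remains to carry circularity from one surface to the other. In every dimension, a circle that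
  touches \<open>a\<close> and \<open>b\<close> at the two ends of an edge \<open>d\<close> exists if \<open>b\<close> is a multiple of the reflection of
  \<open>a\<close> in the hyperplane orthogonal to \<open>d\<close>, and \<open>a\<close> is not parallel to \<open>d\<close>; in the complex plane the
  factor is positive, in accordance with the orientation chosen for planar circularity.
  Stereographic projection is a Moebius map and therefore intertwines these reflections
  (\<open>reflect_wvec\<close>); dual surfaces have parallel edges and parallel derivatives, so they share them.
  The reflection law also makes three vectors \<open>a, b, d\<close> coplanar, which gives conjugacy. A line that is
  tangent to a sphere is never a chord of it, so the non-degeneracy comes for free.

  Solvability of the two equations is a statement about integrability: the \<open>t\<close>-derivative of the right
  hand side for \<open>\<Delta>x\<close> has to be the difference of the right hand sides for \<open>\<partial>x\<close>. This reduces to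
  \<open>g' g\<^sub>1' = - (\<tau> / \<sigma>) (\<Delta>g)\<^sup>2\<close>, which is the reflection law together with the metric condition.

  For the converse, let \<open>y\<close> be the dual in a sphere. As \<open>\<Delta>y = \<sigma> \<Delta>x / \<bar>\<Delta>x\<bar>\<^sup>2\<close> and the derivative of an
  inversion is a reflection, differentiation in \<open>t\<close> yields a linear relation between \<open>\<partial>x\<close>, \<open>\<partial>x\<^sub>1\<close> and their
  reflections. Its only solution is the reflection law with the positive factor \<open>\<nu>\<^sub>1 / \<nu>\<close>, because \<open>\<partial>x\<close> is
  tangent to the sphere (\<open>spherical_dual_edge_reflect\<close>). Projecting \<open>y\<close> stereographically gives \<open>g\<close>.
  If the reflection law holds but \<open>\<partial>g\<close> is parallel to \<open>\<Delta>g\<close>, the edge is straight, and the corresponding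
  circle on the sphere passes through the centre of projection. Finally, \<open>y\<close> consists of countably many
  differentiable curves, so it misses a point of the sphere, which a rotation moves to the north pole.
\<close>

section \<open>Reflections and inversion\<close>

text \<open>The reflection in the hyperplane orthogonal to \<open>d\<close>; for \<open>d = 0\<close> it is the identity.\<close>

definition reflect :: "'a::real_inner \<Rightarrow> 'a \<Rightarrow> 'a" where
  "reflect d v = v - (2 * (v \<bullet> d) / (d \<bullet> d)) *\<^sub>R d"

lemma reflect_scaleR_axis: "c \<noteq> 0 \<Longrightarrow> reflect (c *\<^sub>R d) v = reflect d v"
  by (simp add: reflect_def)

lemma reflect_scaleR: "reflect d (c *\<^sub>R v) = c *\<^sub>R reflect d v"
  by (simp add: reflect_def scaleR_diff_right)

lemma reflect_diff: "reflect d (v - w) = reflect d v - reflect d w"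
  by (simp add: reflect_def inner_diff_left diff_divide_distrib algebra_simps)

lemma norm_reflect [simp]: "norm (reflect d v) = norm v"
proof (cases "d = 0")
  case False
  then have "d \<bullet> d \<noteq> 0" by simp
  then have "reflect d v \<bullet> reflect d v = v \<bullet> v"
    by (simp add: reflect_def inner_diff_left inner_diff_right inner_commute field_simps)
  then show ?thesis by (simp add: norm_eq_sqrt_inner)
qed (simp add: reflect_def)

lemma reflect_reflect: "reflect d (reflect d v) = v"
proof (cases "d = 0")
  case False
  then show ?thesis by (simp add: reflect_def inner_diff_left algebra_simps)
qed (simp add: reflect_def)

lemma reflect_inner_axis: "reflect d v \<bullet> d = - (v \<bullet> d)"
  by (cases "d = 0") (simp_all add: reflect_def inner_diff_left)

lemma reflect_complex:
  assumes "d \<noteq> 0"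
  shows "reflect d a = - (d * cnj a / cnj d)"
proof -
  obtain x y u v where [simp]: "d = Complex x y" "a = Complex u v" by (metis complex.collapse)
  have 1: "x*x+y*y \<noteq> 0" using assms by (auto simp: complex_eq_iff sum_squares_eq_zero_iff)
  show ?thesis
    using 1 by (simp add: reflect_def complex_eq_iff Re_divide Im_divide inner_complex_def power2_eq_square)
      (simp add: divide_simps, simp add: algebra_simps)
qed

text \<open>The inversion in the unit sphere is conformal: its derivative at a point is a reflection along
  the radius, divided by the squared distance from the centre.\<close>

lemma has_vector_derivative_inversion:
  fixes u :: "real \<Rightarrow> 'a::real_inner"
  assumes u: "(u has_vector_derivative u') (at t)" and ne: "u t \<noteq> 0"
  shows "((\<lambda>s. (1 / (u s \<bullet> u s)) *\<^sub>R u s) has_vector_derivative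
    (1 / (u t \<bullet> u t)) *\<^sub>R reflect (u t) u') (at t)"
proof -
  have "((\<lambda>s. u s \<bullet> u s) has_derivative (\<lambda>h. u t \<bullet> (h *\<^sub>R u') + (h *\<^sub>R u') \<bullet> u t)) (at t)"
    using u unfolding has_vector_derivative_def by (intro has_derivative_inner)
  then have sq: "((\<lambda>s. u s \<bullet> u s) has_real_derivative 2 * (u' \<bullet> u t)) (at t)"
    unfolding has_field_derivative_def
    by (rule has_derivative_eq_rhs) (auto simp: inner_commute)
  have n: "u t \<bullet> u t \<noteq> 0" using ne by simp
  have "((\<lambda>s. 1 / (u s \<bullet> u s)) has_real_derivative - (2 * (u' \<bullet> u t)) / (u t \<bullet> u t)\<^sup>2) (at t)"
    using n by (auto intro!: derivative_eq_intros sq simp: power2_eq_square)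
  from has_vector_derivative_scaleR[OF this u] show ?thesis
    by (rule has_vector_derivative_eq_rhs)
       (use n in \<open>simp add: reflect_def scaleR_diff_right power2_eq_square\<close>)
qed

text \<open>Put \<open>u = B - reflect d A\<close>. The equation becomes \<open>q reflect d u = - p u\<close>, which forces \<open>u\<close> to be
  parallel to \<open>d\<close>. Two vectors of equal length on a line in direction \<open>d\<close> are equal or each other's
  reflections, so \<open>u \<noteq> 0\<close> leaves only \<open>B = A\<close>, and then \<open>A \<bullet> d = 0\<close> means that \<open>A\<close> is its own reflection.\<close>

lemma reflect_unique:
  fixes A B d :: "'a::real_inner"
  assumes pos: "p > 0" "q > 0" and d: "d \<noteq> 0"
    and eq: "q *\<^sub>R reflect d B - p *\<^sub>R reflect d A = q *\<^sub>R A - p *\<^sub>R B"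
    and n: "norm A = norm B" and par: "A = B \<Longrightarrow> A \<bullet> d = 0"
  shows "B = reflect d A"
proof -
  define u where "u = B - reflect d A"
  \<comment> \<open>\<open>e\<close> is the coefficient that \<open>q reflect d u = - p u\<close> gives for \<open>u = e d\<close>.\<close>
  define e where "e = 1 / (q + p) * (2 * q * (u \<bullet> d) / (d \<bullet> d))"
  have dd: "d \<bullet> d > 0" using d by simp
  have "q *\<^sub>R reflect d u = - p *\<^sub>R u"
    using eq unfolding u_def reflect_diff reflect_reflect scaleR_diff_right by (simp add: algebra_simps)
  then have "(q + p) *\<^sub>R u = (2 * q * (u \<bullet> d) / (d \<bullet> d)) *\<^sub>R d"
    unfolding reflect_def[of d u] by (simp add: algebra_simps)
  then have "(1 / (q + p)) *\<^sub>R ((q + p) *\<^sub>R u) = (1 / (q + p)) *\<^sub>R ((2 * q * (u \<bullet> d) / (d \<bullet> d)) *\<^sub>R d)"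
    by simp
  then have "u = e *\<^sub>R d" using pos unfolding scaleR_scaleR e_def[symmetric] by simp
  then have B: "B = reflect d A + e *\<^sub>R d" by (simp add: u_def algebra_simps)
  have "A \<bullet> A = B \<bullet> B" using n by (simp add: norm_eq)
  also have "\<dots> = reflect d A \<bullet> reflect d A + 2 * e * (reflect d A \<bullet> d) + e\<^sup>2 * (d \<bullet> d)"
    unfolding B by (simp add: inner_add_left inner_add_right inner_commute power2_eq_square)
  also have "reflect d A \<bullet> reflect d A = A \<bullet> A" by (simp only: norm_eq[symmetric] norm_reflect)
  finally have "e * (e * (d \<bullet> d) - 2 * (A \<bullet> d)) = 0"
    by (auto simp: reflect_inner_axis algebra_simps power2_eq_square)
  moreover have "e = 0" if *: "e * (d \<bullet> d) = 2 * (A \<bullet> d)"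
  proof -
    have "e = 2 * (A \<bullet> d) / (d \<bullet> d)" using * dd by (simp add: field_simps)
    then have "A = B" unfolding B by (simp add: reflect_def)
    then show ?thesis using par * dd by simp
  qed
  ultimately have "e = 0" by (metis eq_iff_diff_eq_0 mult_eq_0_iff)
  then show ?thesis using B by simp
qed

section \<open>Stereographic projection\<close>

lemma vec3_eq_iff: "(x::real^3) = y \<longleftrightarrow> x$1 = y$1 \<and> x$2 = y$2 \<and> x$3 = y$3"
  by (simp add: vec_eq_iff forall_3)

lemma inner_vec3: "(x::real^3) \<bullet> y = x$1 * y$1 + x$2 * y$2 + x$3 * y$3"
  by (simp add: inner_vec_def sum_3)

lemma norm_vec3: "(norm (x::real^3))\<^sup>2 = (x$1)\<^sup>2 + (x$2)\<^sup>2 + (x$3)\<^sup>2"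
  unfolding power2_norm_eq_inner by (simp only: inner_vec3 power2_eq_square)

lemma vector3_expand: "(vector [a, b, c] :: real^3) = a *\<^sub>R axis 1 1 + b *\<^sub>R axis 2 1 + c *\<^sub>R axis 3 1"
  by (simp add: vec3_eq_iff axis_def)

text \<open>The vector of the Weierstrass representation. It is used with \<open>h = g\<close> for derivatives and with
  \<open>h = g\<^sub>1\<close> for differences.\<close>

definition wvec :: "complex \<Rightarrow> complex \<Rightarrow> complex \<Rightarrow> real^3" where
  "wvec g h p = vector [Re ((1 - g * h) * p), Re (\<i> * (1 + g * h) * p), Re ((g + h) * p)]"

text \<open>The conformal factor of the inverse stereographic projection is \<open>2\<close> divided by this function.\<close>

definition stereo_denom :: "complex \<Rightarrow> real" where
  "stereo_denom z = 1 + (cmod z)\<^sup>2"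

definition inv_stereo :: "complex \<Rightarrow> real^3" where
  "inv_stereo z = (1 / stereo_denom z) *\<^sub>R vector [2 * Re z, 2 * Im z, (cmod z)\<^sup>2 - 1]"

lemma stereo_denom_pos [simp]: "stereo_denom z > 0" "stereo_denom z \<noteq> 0"
  unfolding stereo_denom_def by (smt (verit) zero_le_power2)+

lemma stereo_denom_Re_Im: "stereo_denom z = 1 + (Re z)\<^sup>2 + (Im z)\<^sup>2"
  by (simp add: stereo_denom_def cmod_power2)

lemma wvec_scaleR: "wvec g h (c *\<^sub>R p) = c *\<^sub>R wvec g h p"
  by (simp add: wvec_def vec3_eq_iff algebra_simps)

lemma wvec_diff: "wvec g h (p - q) = wvec g h p - wvec g h q"
  by (simp add: wvec_def vec3_eq_iff algebra_simps)

lemma norm_wvec_tangent: "(norm (wvec g g p))\<^sup>2 = (stereo_denom g)\<^sup>2 * (cmod p)\<^sup>2"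
proof -
  obtain x y u v where [simp]: "g = Complex x y" "p = Complex u v" by (metis complex.collapse)
  show ?thesis
    unfolding norm_vec3 wvec_def stereo_denom_Re_Im cmod_power2
    by simp algebra
qed

lemma norm_wvec_chord: "(norm (wvec g h (cnj (h - g))))\<^sup>2 = stereo_denom g * stereo_denom h * (cmod (h - g))\<^sup>2"
proof -
  obtain x y u v where [simp]: "g = Complex x y" "h = Complex u v" by (metis complex.collapse)
  show ?thesis
    unfolding norm_vec3 wvec_def stereo_denom_Re_Im cmod_power2
    by simp algebra
qed

lemma wvec_zero_iff: "wvec z z (cnj v) = 0 \<longleftrightarrow> v = 0"
proof
  assume "wvec z z (cnj v) = 0"
  then show "v = 0" using norm_wvec_tangent[of z "cnj v"] by simp
qed (simp add: wvec_def vec3_eq_iff)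

lemma wvec_inverse: "wvec g h (inverse p) = (1 / (cmod p)\<^sup>2) *\<^sub>R wvec g h (cnj p)"
proof -
  have "inverse p = (1 / (cmod p)\<^sup>2) *\<^sub>R cnj p"
    by (simp add: complex_eq_iff cmod_power2 Re_divide)
  then show ?thesis by (simp add: wvec_scaleR)
qed

lemma weierstrass_wvec:
  "vector [Re ((1 - g\<^sup>2) / p), Re (\<i> * (1 + g\<^sup>2) / p), Re (2 * g / p)] = wvec g g (inverse p)"
  "vector [Re ((1 - g * h) / p), Re (\<i> * (1 + g * h) / p), Re ((g + h) / p)] = wvec g h (inverse p)"
  by (simp_all add: wvec_def divide_inverse power2_eq_square)

text \<open>This is, up to scaling, half the derivative with respect to \<open>g\<close> in direction \<open>a\<close> of the negative
  squared chord length \<open>\<bar>n h - n g\<bar>\<^sup>2 = 4 \<bar>h - g\<bar>\<^sup>2 / ((1 + \<bar>g\<bar>\<^sup>2) (1 + \<bar>h\<bar>\<^sup>2))\<close>.\<close>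

lemma inner_wvec: "wvec g g (cnj a) \<bullet> wvec g h (cnj (h - g)) =
   stereo_denom g * (stereo_denom g * (a \<bullet> (h - g)) + (cmod (h - g))\<^sup>2 * (g \<bullet> a))"
proof -
  obtain x y u v p q where [simp]: "g = Complex x y" "h = Complex u v" "a = Complex p q"
    by (metis complex.collapse)
  show ?thesis
    unfolding inner_vec3 wvec_def stereo_denom_Re_Im cmod_power2 inner_complex_def
    by simp algebra
qed

lemma inv_stereo_diff:
  "inv_stereo h - inv_stereo g = (2 / (stereo_denom g * stereo_denom h)) *\<^sub>R wvec g h (cnj (h - g))"
proof -
  have *: "stereo_denom g \<noteq> 0" "stereo_denom h \<noteq> 0" by auto
  show ?thesis
    unfolding vec3_eq_iff inv_stereo_def wvec_def
    using * apply (simp add: divide_simps)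
    apply (simp add: stereo_denom_Re_Im cmod_power2)
    apply (simp add: algebra_simps power2_eq_square)
    done
qed

lemma has_vector_derivative_inv_stereo:
  assumes "(g has_vector_derivative a) (at t)"
  shows "((\<lambda>s. inv_stereo (g s)) has_vector_derivative
    (2 / (stereo_denom (g t))\<^sup>2) *\<^sub>R wvec (g t) (g t) (cnj a)) (at t)"
proof -
  have R: "((\<lambda>s. Re (g s)) has_real_derivative Re a) (at t)"
    and I: "((\<lambda>s. Im (g s)) has_real_derivative Im a) (at t)"
    using assms has_vector_derivative_complex_iff by auto
  have H: "((\<lambda>s. stereo_denom (g s)) has_real_derivative 2 * Re (g t) * Re a + 2 * Im (g t) * Im a) (at t)"
    unfolding stereo_denom_Re_Im by (rule derivative_eq_intros R I assms refl | simp)+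
  have E: "inv_stereo z = (2 * Re z / stereo_denom z) *\<^sub>R axis 1 1 + (2 * Im z / stereo_denom z) *\<^sub>R axis 2 1
      + ((stereo_denom z - 2) / stereo_denom z) *\<^sub>R axis 3 1" for z
    by (simp add: inv_stereo_def vector3_expand scaleR_add_right stereo_denom_def)
  have 1: "((\<lambda>s. 2 * Re (g s) / stereo_denom (g s)) has_real_derivative
     (2 * Re a * stereo_denom (g t) - 2 * Re (g t) * (2 * Re (g t) * Re a + 2 * Im (g t) * Im a)) / (stereo_denom (g t))\<^sup>2) (at t)"
    by (auto intro!: derivative_eq_intros R H assms simp: power2_eq_square)
  have 2: "((\<lambda>s. 2 * Im (g s) / stereo_denom (g s)) has_real_derivative
     (2 * Im a * stereo_denom (g t) - 2 * Im (g t) * (2 * Re (g t) * Re a + 2 * Im (g t) * Im a)) / (stereo_denom (g t))\<^sup>2) (at t)"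
    by (auto intro!: derivative_eq_intros I H assms simp: power2_eq_square)
  have 3: "((\<lambda>s. (stereo_denom (g s) - 2) / stereo_denom (g s)) has_real_derivative
     (2 * (2 * Re (g t) * Re a + 2 * Im (g t) * Im a)) / (stereo_denom (g t))\<^sup>2) (at t)"
    by (auto intro!: derivative_eq_intros H simp: power2_eq_square algebra_simps)
  show ?thesis
    unfolding E
    apply (rule has_vector_derivative_eq_rhs)
     apply (rule has_vector_derivative_add has_vector_derivative_scaleR[OF _ has_vector_derivative_const] 1 2 3)+
    apply (simp add: vec3_eq_iff axis_def wvec_def divide_simps)
    apply (simp add: stereo_denom_Re_Im algebra_simps power2_eq_square)
    done
qed

text \<open>The polynomial identity behind \<open>reflect_wvec\<close>, with all denominators cleared.\<close>

lemma wvec_reflect_poly: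
  fixes a g h :: complex
  defines "d \<equiv> h - g"
  shows "stereo_denom g *\<^sub>R wvec h h (cnj ((cmod d)\<^sup>2 *\<^sub>R a - (2 * (a \<bullet> d)) *\<^sub>R d)) =
     (stereo_denom h * (cmod d)\<^sup>2) *\<^sub>R wvec g g (cnj a)
     - (2 * (stereo_denom g * (a \<bullet> d) + (cmod d)\<^sup>2 * (g \<bullet> a))) *\<^sub>R wvec g h (cnj d)"
proof -
  obtain x y u v p q where [simp]: "d = Complex x y" "a = Complex u v" "g = Complex p q"
    by (metis complex.collapse)
  have h[simp]: "h = Complex (p+x) (q+y)" using \<open>d = Complex x y\<close> \<open>g = Complex p q\<close> unfolding d_def by (simp add: complex_eq_iff algebra_simps)
  show ?thesis
    unfolding vec3_eq_iff wvec_def stereo_denom_Re_Im cmod_power2 inner_complex_def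
    apply simp
    apply (intro conjI)
    apply algebra+
    done
qed

text \<open>A circle touching \<open>a\<close> at \<open>g\<close> and passing through \<open>h\<close> is mapped by the inverse stereographic projection
  to a circle, and its tangent at \<open>h\<close> to a tangent. In the plane and in space the tangent at the second
  end of a chord is the reflection of the tangent at the first end, so the derivative of the projection
  intertwines the two reflections. The factor is the ratio of the conformal factors.\<close>

lemma reflect_wvec:
  assumes "h \<noteq> g"
  shows "wvec h h (cnj (reflect (h - g) a)) =
    (stereo_denom h / stereo_denom g) *\<^sub>R reflect (wvec g h (cnj (h - g))) (wvec g g (cnj a))"
proof -
  define d where "d = h - g"
  have d: "cmod d ^ 2 > 0" "d \<bullet> d = (cmod d)\<^sup>2" using assms
    by (auto simp: d_def power2_norm_eq_inner)
  have W: "wvec g h (cnj d) \<bullet> wvec g h (cnj d) = stereo_denom g * stereo_denom h * (cmod d)\<^sup>2"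
    using norm_wvec_chord[of g h] by (simp only: d_def power2_norm_eq_inner)
  have r: "reflect d a = (1/(cmod d)\<^sup>2) *\<^sub>R ((cmod d)\<^sup>2 *\<^sub>R a - (2 * (a \<bullet> d)) *\<^sub>R d)"
    using d by (simp add: reflect_def scaleR_diff_right)
  have "wvec h h (cnj (reflect d a)) = (1/(stereo_denom g * (cmod d)\<^sup>2)) *\<^sub>R
     (stereo_denom g *\<^sub>R wvec h h (cnj ((cmod d)\<^sup>2 *\<^sub>R a - (2 * (a \<bullet> d)) *\<^sub>R d)))"
    unfolding r complex_cnj_scaleR wvec_scaleR by simp
  also have "\<dots> = (1/(stereo_denom g * (cmod d)\<^sup>2)) *\<^sub>R ((stereo_denom h * (cmod d)\<^sup>2) *\<^sub>R wvec g g (cnj a)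
     - (2 * (stereo_denom g * (a \<bullet> d) + (cmod d)\<^sup>2 * (g \<bullet> a))) *\<^sub>R wvec g h (cnj d))"
    unfolding d_def wvec_reflect_poly ..
  also have "\<dots> = (stereo_denom h / stereo_denom g) *\<^sub>R reflect (wvec g h (cnj d)) (wvec g g (cnj a))"
    unfolding reflect_def W using d
    by (simp add: inner_wvec[of g a h, folded d_def] scaleR_diff_right)
  finally show ?thesis by (simp add: d_def)
qed

lemma inv_stereo_inner_wvec: "inv_stereo g \<bullet> wvec g g p = 0"
proof -
  obtain x y u v where [simp]: "g = Complex x y" "p = Complex u v" by (metis complex.collapse)
  have "vector [2 * Re g, 2 * Im g, (cmod g)\<^sup>2 - 1] \<bullet> wvec g g p = 0"
    unfolding inner_vec3 wvec_def cmod_power2 by simp algebra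
  then show ?thesis by (simp add: inv_stereo_def)
qed

lemma norm_inv_stereo [simp]: "norm (inv_stereo g) = 1"
proof -
  obtain x y where g: "g = Complex x y" by (metis complex.collapse)
  have "(norm (vector [2 * Re g, 2 * Im g, (cmod g)\<^sup>2 - 1] :: real^3))\<^sup>2 = (stereo_denom g)\<^sup>2"
    unfolding norm_vec3 stereo_denom_Re_Im cmod_power2 g by simp algebra
  then have "norm (vector [2 * Re g, 2 * Im g, (cmod g)\<^sup>2 - 1] :: real^3) = stereo_denom g"
    by (simp add: power2_eq_iff_nonneg less_imp_le)
  then show ?thesis by (simp add: inv_stereo_def less_imp_le)
qed

definition stereo :: "real^3 \<Rightarrow> complex" where
  "stereo p = Complex (p$1 / (1 - p$3)) (p$2 / (1 - p$3))"

lemma unit_sphere_north_pole: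
  fixes p :: "real^3"
  assumes "norm p = 1" "p \<noteq> vector [0,0,1]" shows "p$3 < 1"
proof -
  have 1: "(p$1)\<^sup>2 + (p$2)\<^sup>2 + (p$3)\<^sup>2 = 1" using norm_vec3[of p] assms by simp
  have "p$3 \<noteq> 1" using 1 assms(2) by (auto simp: vec3_eq_iff sum_power2_eq_zero_iff)
  moreover have "p$3 \<le> 1" using component_le_norm_cart[of p 3] assms by simp
  ultimately show ?thesis by simp
qed

lemma inv_stereo_stereo:
  assumes "norm p = 1" "p$3 < 1" shows "inv_stereo (stereo p) = p"
proof -
  have 1: "(p$1)\<^sup>2 + (p$2)\<^sup>2 + (p$3)\<^sup>2 = 1" using norm_vec3[of p] assms by simp
  have N: "(cmod (stereo p))\<^sup>2 = (1 + p$3) / (1 - p$3)"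
  proof -
    have "(cmod (stereo p))\<^sup>2 = ((p$1)\<^sup>2 + (p$2)\<^sup>2) / (1 - p$3)\<^sup>2"
      by (simp add: cmod_power2 stereo_def power_divide add_divide_distrib)
    also have "(p$1)\<^sup>2 + (p$2)\<^sup>2 = (1 + p$3) * (1 - p$3)" using 1 by (simp add: algebra_simps power2_eq_square)
    finally show ?thesis using assms by (simp add: power2_eq_square)
  qed
  have H: "stereo_denom (stereo p) = 2 / (1 - p$3)" using assms by (simp add: stereo_denom_def N field_simps)
  have "1 - p$3 \<noteq> 0" using assms by simp
  moreover have "(1 + p$3) / (1 - p$3) - 1 = 2 * p$3 / (1 - p$3)"
    using \<open>1 - p$3 \<noteq> 0\<close> by (simp add: divide_simps)
  ultimately show ?thesis
    unfolding inv_stereo_def H vec3_eq_iff N by (simp add: stereo_def)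
qed

lemma has_vector_derivative_stereo:
  assumes p: "(p has_vector_derivative p') (at t)" and ne: "p t $ 3 \<noteq> 1"
  shows "((\<lambda>s. stereo (p s)) has_vector_derivative
    Complex ((p' $ 1 * (1 - p t $ 3) + p t $ 1 * p' $ 3) / (1 - p t $ 3)\<^sup>2)
            ((p' $ 2 * (1 - p t $ 3) + p t $ 2 * p' $ 3) / (1 - p t $ 3)\<^sup>2)) (at t)"
proof -
  have c: "((\<lambda>s. p s $ i) has_real_derivative p' $ i) (at t)" for i
    using bounded_linear.has_vector_derivative[OF bounded_linear_vec_nth p]
    by (simp add: has_real_derivative_iff_has_vector_derivative)
  have q: "((\<lambda>s. p s $ i / (1 - p s $ 3)) has_real_derivative
      (p' $ i * (1 - p t $ 3) + p t $ i * p' $ 3) / (1 - p t $ 3)\<^sup>2) (at t)" for i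
    using ne by (auto intro!: derivative_eq_intros c simp: power2_eq_square)
  show ?thesis
    unfolding has_vector_derivative_complex_iff stereo_def using q by simp
qed

section \<open>Circles through edges\<close>

text \<open>In complex notation the reflection law is \<open>b = - \<mu> d cnj a / cnj d\<close>. If \<open>d\<close> is orthogonal to the sum of
  the unit vectors \<open>A\<close> and \<open>B\<close>, then \<open>cnj d B = - d cnj A\<close>, which is this law with \<open>\<mu> = \<bar>b\<bar> / \<bar>a\<bar>\<close>.
  Conversely \<open>A + B\<close> is then \<open>2 \<i> d Im (a / d) / \<bar>a\<bar>\<close>, so that \<open>s\<close> can be found unless \<open>a / d\<close> is real.\<close>

lemma planar_arc_iff_reflect:
  fixes a b d :: complex
  assumes "a \<noteq> 0" "b \<noteq> 0" "d \<noteq> 0"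
  shows "(\<exists>s::real. s \<noteq> 0 \<and> d = \<i> * of_real s * (sgn a + sgn b)) \<longleftrightarrow>
    (\<exists>\<mu>>0. b = \<mu> *\<^sub>R reflect d a) \<and> Im (a / d) \<noteq> 0" (is "?L \<longleftrightarrow> ?R")
proof
  assume ?L
  then obtain s :: real where s: "s \<noteq> 0" "d = \<i> * of_real s * (sgn a + sgn b)" by auto
  define A where "A = sgn a" define B where "B = sgn b"
  have nA: "A * cnj A = 1" "B * cnj B = 1"
    using assms by (simp_all add: A_def B_def complex_norm_square[symmetric] norm_sgn)
  have aA: "a = of_real (norm a) * A" "b = of_real (norm b) * B"
    using assms by (simp_all add: A_def B_def sgn_div_norm scaleR_conv_of_real)
  have ca: "cnj a = of_real (norm a) * cnj A" by (subst aA(1)) simp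
  have AB: "A + B \<noteq> 0" using s assms by (auto simp: A_def B_def)
  have d: "d = \<i> * of_real s * (A + B)" using s by (simp add: A_def B_def)
  have "cnj d \<noteq> 0" using assms by simp
  have "cnj d * B = - d * cnj A"
    unfolding d using nA by (simp add: algebra_simps)
  then have B: "B = - (d * cnj A / cnj d)" using \<open>cnj d \<noteq> 0\<close> by (simp add: field_simps)
  have "b = of_real (norm b / norm a) * (- (d * cnj a / cnj d))"
  proof -
    have "of_real (norm b / norm a) * (- (d * cnj a / cnj d)) = of_real (norm b) * (- (d * cnj A / cnj d))"
      unfolding ca using assms by simp
    then show ?thesis using aA(2) B by simp
  qed
  then have b: "b = (norm b / norm a) *\<^sub>R reflect d a"
    by (simp only: reflect_complex[OF assms(3)] scaleR_conv_of_real)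
  have "Im (a / d) \<noteq> 0"
  proof
    assume "Im (a / d) = 0"
    then have "cnj (a / d) = a / d" by (simp add: complex_eq_iff del: complex_cnj_divide)
    then have "d * cnj a / cnj d = a" using assms by (simp add: field_simps)
    then have "of_real (norm a) * (d * cnj A / cnj d) = of_real (norm a) * A"
      using aA(1) ca by (metis mult.assoc mult.commute times_divide_eq_right)
    then have "d * cnj A / cnj d = A" using assms(1) by (simp only: mult_cancel_left) simp
    then show False using AB B by simp
  qed
  then show ?R using b assms by (metis divide_pos_pos zero_less_norm_iff)
next
  assume ?R
  then obtain \<mu> where \<mu>: "\<mu> > 0" "b = \<mu> *\<^sub>R reflect d a" and im: "Im (a / d) \<noteq> 0" by blast
  have "sgn b = sgn (reflect d a)" using \<mu> by (simp add: sgn_scaleR)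
  also have "\<dots> = - (d * cnj a / cnj d) / norm a"
    using reflect_complex[OF assms(3)] norm_reflect[of d a] by (simp add: sgn_eq)
  finally have sb: "sgn b = - (d * cnj a / cnj d) / norm a" .
  have "sgn a + sgn b = d * (a / d - cnj (a / d)) / norm a"
    unfolding sb using assms by (simp add: sgn_eq field_simps)
  also have "a / d - cnj (a / d) = 2 * \<i> * Im (a / d)"
    by (simp add: complex_eq_iff del: complex_cnj_divide)
  finally have "d = \<i> * of_real (- norm a / (2 * Im (a / d))) * (sgn a + sgn b)"
    using im assms by (simp add: field_simps)
  then show ?L using im assms by (intro exI[of _ "- norm a / (2 * Im (a / d))"]) auto
qed

text \<open>The excluded case of the previous lemma: \<open>a\<close> is parallel to \<open>d\<close>, so that its reflection is \<open>- a\<close>.\<close>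

lemma planar_straight_if_reflect:
  fixes a b d :: complex
  assumes "a \<noteq> 0" "d \<noteq> 0" "\<mu> > 0" "b = \<mu> *\<^sub>R reflect d a" "Im (a / d) = 0"
  shows "sgn a + sgn b = 0" "\<exists>s::real. s \<noteq> 0 \<and> d = of_real s * sgn a"
proof -
  define q where "q = Re (a / d)"
  have "a / d = of_real q" using assms by (simp add: q_def complex_eq_iff)
  then have q: "a = of_real q * d" using assms by (simp add: field_simps)
  then have "q \<noteq> 0" using assms by auto
  have "reflect d a = - a" using assms by (simp add: reflect_complex q)
  then show "sgn a + sgn b = 0" using assms by (simp add: sgn_scaleR sgn_minus)
  have "d = of_real (norm a / q) * sgn a"
    using \<open>q \<noteq> 0\<close> assms by (simp add: sgn_eq) (simp add: q)
  then show "\<exists>s::real. s \<noteq> 0 \<and> d = of_real s * sgn a"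
    using \<open>q \<noteq> 0\<close> assms by (intro exI[of _ "norm a / q"]) auto
qed

text \<open>The vector \<open>w\<close> from the centre to \<open>p\<close> has to lie in the plane of \<open>a\<close> and \<open>d\<close> and satisfy \<open>w \<bullet> a = 0\<close>
  and \<open>w \<bullet> d = - \<bar>d\<bar>\<^sup>2 / 2\<close>; this linear system has the Gram matrix of \<open>a\<close> and \<open>d\<close>, of determinant
  \<open>\<bar>a \<times> d\<bar>\<^sup>2\<close>. The circle is symmetric with respect to the bisecting plane of the chord \<open>d\<close>, and this
  symmetry takes the tangent \<open>a\<close> to a tangent parallel to \<open>b\<close>.\<close>

lemma circle_through_reflected_edge:
  fixes p a b d :: "real^3"
  assumes ad: "cross3 a d \<noteq> 0" and b: "b = \<mu> *\<^sub>R reflect d a"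
  shows "\<exists>m n r. r > 0 \<and> n \<noteq> 0 \<and> tangent_to_circle3 m n r p a \<and> tangent_to_circle3 m n r (p + d) b"
proof -
  define G where "G = (a \<bullet> a) * (d \<bullet> d) - (a \<bullet> d)\<^sup>2"
  have "G = (norm (cross3 a d))\<^sup>2" using norm_cross[of a d] by (simp add: G_def power2_norm_eq_inner)
  then have G: "G \<noteq> 0" using ad by simp
  have d0: "d \<bullet> d \<noteq> 0" using ad by auto
  define w where "w = ((a \<bullet> d) * (d \<bullet> d) / (2 * G)) *\<^sub>R a - ((a \<bullet> a) * (d \<bullet> d) / (2 * G)) *\<^sub>R d"
  have wv: "w \<bullet> v = (d \<bullet> d) / (2 * G) * ((a \<bullet> d) * (a \<bullet> v) - (a \<bullet> a) * (d \<bullet> v))" for v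
    by (simp add: w_def inner_diff_left right_diff_distrib mult_ac)
  have wa: "w \<bullet> a = 0" unfolding wv by (simp add: inner_commute)
  have "(a \<bullet> d) * (a \<bullet> d) - (a \<bullet> a) * (d \<bullet> d) = - G" by (simp add: G_def power2_eq_square)
  then have wd: "w \<bullet> d = - (d \<bullet> d) / 2" unfolding wv using G by simp
  have nw: "norm (w + d) = norm w"
    using wd by (simp add: norm_eq_sqrt_inner inner_add_left inner_add_right inner_commute)
  have "w \<noteq> 0" using wd d0 by auto
  have nn: "(cross3 a d) \<bullet> a = 0" "(cross3 a d) \<bullet> d = 0" by (simp_all add: dot_cross_self)
  have nwn: "(cross3 a d) \<bullet> w = 0" using nn by (simp add: w_def inner_diff_right)
  have nb: "(cross3 a d) \<bullet> b = 0" using nn by (simp add: b reflect_def inner_diff_right)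
  have "(w + d) \<bullet> a = a \<bullet> d" "(w + d) \<bullet> d = (d \<bullet> d) / 2" using wa wd
    by (simp_all add: inner_add_left inner_commute[of d a])
  then have wb: "(w + d) \<bullet> b = 0" using d0
    unfolding b reflect_def inner_scaleR_right inner_diff_right by (simp add: nonzero_eq_divide_eq)
  have pw: "p - (p - w) = w" and pdw: "p + d - (p - w) = w + d" by simp_all
  show ?thesis
    apply (rule exI[of _ "p - w"], rule exI[of _ "cross3 a d"], rule exI[of _ "norm w"])
    unfolding tangent_to_circle3_def circle3_def dist_norm mem_Collect_eq pw pdw
    using ad \<open>w \<noteq> 0\<close> nn nwn nb wa wb nw
    by (simp add: inner_add_right)
qed

text \<open>A tangent line of a sphere meets the sphere only once.\<close>

lemma sphere_tangent_not_parallel_chord: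
  fixes a d p :: "real^3"
  assumes "p \<bullet> a = 0" "norm (p + d) = norm p" "a \<noteq> 0" "d \<noteq> 0"
  shows "cross3 a d \<noteq> 0"
proof
  assume "cross3 a d = 0"
  then obtain c where c: "d = c *\<^sub>R a" using assms by (auto simp: cross_eq_0 collinear_lemma)
  have "p \<bullet> d = 0" using assms c by simp
  then show False using assms by (auto simp: norm_eq_sqrt_inner inner_add_left inner_add_right inner_commute)
qed

text \<open>The centre of the section is the foot of the perpendicular from \<open>c\<close> to the plane. The two points \<open>p \<noteq> q\<close>
  ensure that the section is not a single point.\<close>

lemma plane_section_of_sphere:
  fixes c n q :: "real^3"
  assumes "n \<noteq> 0" "q \<in> sphere c r" "p \<in> sphere c r" "p \<noteq> q"
    "n \<bullet> (p - c) = h" "n \<bullet> (q - c) = h"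
  obtains m \<rho> where "\<rho> > 0" "q \<in> circle3 m n \<rho>"
    "\<And>z v. z \<in> sphere c r \<Longrightarrow> n \<bullet> (z - c) = h \<Longrightarrow> (z - c) \<bullet> v = 0 \<Longrightarrow> n \<bullet> v = 0 \<Longrightarrow>
       tangent_to_circle3 m n \<rho> z v"
proof -
  define e where "e = (h / (n \<bullet> n)) *\<^sub>R n"
  have n0: "n \<bullet> n \<noteq> 0" using assms by simp
  have ne: "n \<bullet> e = h" using n0 by (simp add: e_def)
  have ze: "(z - c - e) \<bullet> e = 0" if "n \<bullet> (z - c) = h" for z
  proof -
    have "n \<bullet> (z - c - e) = 0" using that ne by (simp add: inner_diff_right)
    then show ?thesis by (simp add: e_def inner_commute)
  qed
  have pyth: "(norm (z - c - e))\<^sup>2 = r\<^sup>2 - (norm e)\<^sup>2" if "n \<bullet> (z - c) = h" "z \<in> sphere c r" for z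
  proof -
    have "r\<^sup>2 = (norm ((z - c - e) + e))\<^sup>2" using that by (simp add: dist_norm norm_minus_commute)
    also have "\<dots> = (norm (z - c - e))\<^sup>2 + (norm e)\<^sup>2"
      using ze[OF that(1)] by (intro norm_add_Pythagorean) (simp add: orthogonal_def)
    finally show ?thesis by simp
  qed
  define \<rho> where "\<rho> = norm (q - c - e)"
  have R: "norm (z - c - e) = \<rho>" if "n \<bullet> (z - c) = h" "z \<in> sphere c r" for z
    using trans[OF pyth[OF that] pyth[OF assms(6,2), symmetric]] unfolding \<rho>_def
    by (rule power2_eq_imp_eq) (rule norm_ge_zero)+
  have "\<rho> > 0"
  proof (rule ccontr)
    assume "\<not> \<rho> > 0"
    then have "\<rho> = 0" by (simp add: \<rho>_def)
    then have "p - c - e = 0" "q - c - e = 0" using R[OF assms(5,3)] R[OF assms(6,2)] by auto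
    then have "p - c = q - c" by simp
    then show False using assms(4) by simp
  qed
  have C: "z \<in> circle3 (c + e) n \<rho>" if "n \<bullet> (z - c) = h" "z \<in> sphere c r" for z
    using R[OF that] ne that(1) by (simp add: circle3_def dist_norm diff_diff_eq inner_diff_right inner_add_right)
  show ?thesis
  proof (rule that[OF \<open>\<rho> > 0\<close> C[OF assms(6,2)]])
    fix z v assume *: "z \<in> sphere c r" "n \<bullet> (z - c) = h" "(z - c) \<bullet> v = 0" "n \<bullet> v = 0"
    then have "e \<bullet> v = 0" by (simp add: e_def)
    then show "tangent_to_circle3 (c + e) n \<rho> z v"
      unfolding tangent_to_circle3_def
      using C[OF *(2,1)] * by (simp add: inner_diff_left inner_add_left)
  qed
qed

text \<open>The line through \<open>z\<close> in direction \<open>v\<close> corresponds to a circle through the north pole of the sphere,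
  and this is a normal vector of the plane of that circle. The line has the equation
  \<open>Re (cnj (\<i> v) (p - z)) = 0\<close>; substituting the stereographic projection for \<open>p\<close> makes it linear.\<close>

definition line_normal :: "complex \<Rightarrow> complex \<Rightarrow> real^3" where
  "line_normal v z = vector [- Im v, Re v, Re v * Im z - Im v * Re z]"

lemma line_normal_tangent: "line_normal v z \<bullet> wvec z z (cnj v) = 0"
proof -
  obtain x y p q where [simp]: "v = Complex x y" "z = Complex p q" by (metis complex.collapse)
  show ?thesis unfolding inner_vec3 line_normal_def wvec_def by simp algebra
qed

lemma line_normal_inv_stereo: "line_normal v z \<bullet> inv_stereo z = Re v * Im z - Im v * Re z"
proof -
  have "line_normal v z \<bullet> vector [2 * Re z, 2 * Im z, (cmod z)\<^sup>2 - 1] = (Re v * Im z - Im v * Re z) * stereo_denom z"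
    unfolding inner_vec3 line_normal_def by (simp add: stereo_denom_def algebra_simps)
  then show ?thesis by (simp add: inv_stereo_def)
qed

section \<open>Semi-discrete surfaces\<close>

lemma open_slice: assumes "open D" shows "open (slice D k)"
proof -
  have "open ((\<lambda>t. (k, t)) -` D)"
    by (intro open_vimage assms continuous_intros)
  then show ?thesis by (simp add: slice_def vimage_def)
qed

lemma sd_surface_has_derivative:
  "sd_surface D x \<Longrightarrow> (k, t) \<in> D \<Longrightarrow> (x k has_vector_derivative pd x k t) (at t)"
  unfolding sd_surface_def pd_def by (auto simp: vector_derivative_works[symmetric])

lemma sd_surfaceI:
  assumes "\<And>k t. (k, t) \<in> D \<Longrightarrow> (x k has_vector_derivative x' k t) (at t)"
    and "\<And>k. continuous_on (slice D k) (x' k)"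
  shows "sd_surface D x" "\<And>k t. (k, t) \<in> D \<Longrightarrow> pd x k t = x' k t"
proof -
  show pd: "pd x k t = x' k t" if "(k, t) \<in> D" for k t
    using vector_derivative_at[OF assms(1)[OF that]] by (simp add: pd_def)
  have "continuous_on (slice D k) (pd x k)" for k
    using assms(2)[of k] by (rule continuous_on_eq) (simp add: pd slice_def)
  then show "sd_surface D x"
    using assms(1) by (auto simp: sd_surface_def intro: differentiableI_vector)
qed

lemma sd_surface_continuous: "sd_surface D x \<Longrightarrow> continuous_on (slice D k) (x k)"
  by (auto intro!: differentiable_imp_continuous_on differentiable_at_imp_differentiable_on
      simp: sd_surface_def slice_def)

text \<open>The relation between the two derivatives along an edge of a circular surface. It depends only on
  the directions of the three vectors, and is therefore shared by dual surfaces.\<close>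

definition reflected_edge :: "(int \<Rightarrow> real \<Rightarrow> 'a::real_inner) \<Rightarrow> int \<Rightarrow> real \<Rightarrow> bool" where
  "reflected_edge x k t \<longleftrightarrow> (\<exists>\<mu>. pd x (k + 1) t = \<mu> *\<^sub>R reflect (diff x k t) (pd x k t))"

lemma conjugate_if_reflected:
  assumes "\<And>k t. (k, t) \<in> edges D \<Longrightarrow> reflected_edge x k t"
  shows "conjugate D x"
  unfolding conjugate_def
proof clarify
  fix k t assume "(k, t) \<in> edges D"
  then obtain \<mu> where \<mu>: "pd x (k + 1) t = \<mu> *\<^sub>R reflect (diff x k t) (pd x k t)"
    using assms unfolding reflected_edge_def by blast
  have "(1 - \<mu>) *\<^sub>R pd x k t
     + (\<mu> * (2 * (pd x k t \<bullet> diff x k t) / (diff x k t \<bullet> diff x k t))) *\<^sub>R diff x k t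
     + 1 *\<^sub>R diff (pd x) k t = 0"
    unfolding diff_def[of "pd x"] \<mu> reflect_def by (simp add: algebra_simps)
  then show "\<exists>a b c. (a, b, c) \<noteq> (0, 0, 0) \<and>
        a *\<^sub>R pd x k t + b *\<^sub>R diff x k t + c *\<^sub>R diff (pd x) k t = 0"
    by (metis prod.inject zero_neq_one)
qed

lemma circular_if_reflected:
  assumes "\<And>k t. (k, t) \<in> edges D \<Longrightarrow> reflected_edge x k t"
    and "\<And>k t. (k, t) \<in> edges D \<Longrightarrow> cross3 (pd x k t) (diff x k t) \<noteq> 0"
  shows "circular D x"
  unfolding circular_def
proof clarify
  fix k t assume e: "(k, t) \<in> edges D"
  then obtain \<mu> where "pd x (k + 1) t = \<mu> *\<^sub>R reflect (diff x k t) (pd x k t)"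
    using assms unfolding reflected_edge_def by blast
  from circle_through_reflected_edge[OF assms(2)[OF e] this, of "x k t"]
  show "\<exists>m n r. edge_circle x k t m n r" unfolding edge_circle_def by (simp add: diff_def)
qed

lemma isothermic_metricD:
  assumes "isothermic_metric D x \<nu> \<sigma> \<tau>"
  shows "(k, t) \<in> D \<Longrightarrow> \<nu> k t > 0" "(k, t) \<in> D \<Longrightarrow> \<tau> k t > 0"
    "(k, t) \<in> D \<Longrightarrow> (norm (pd x k t))\<^sup>2 = \<tau> k t * (\<nu> k t)\<^sup>2"
    "(k, t) \<in> edges D \<Longrightarrow> \<sigma> k t > 0"
    "(k, t) \<in> edges D \<Longrightarrow> (norm (diff x k t))\<^sup>2 = \<sigma> k t * \<nu> k t * \<nu> (k + 1) t"
    "(k, t) \<in> edges D \<Longrightarrow> (\<sigma> k has_real_derivative 0) (at t)"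
    "(k, t) \<in> edges D \<Longrightarrow> \<tau> (k + 1) t = \<tau> k t"
    "continuous_on (slice D k) (\<nu> k)"
    "(k, t) \<in> D \<Longrightarrow> pd x k t \<noteq> 0"
    "(k, t) \<in> edges D \<Longrightarrow> diff x k t \<noteq> 0"
proof -
  show *: "(k, t) \<in> D \<Longrightarrow> \<nu> k t > 0" "(k, t) \<in> D \<Longrightarrow> \<tau> k t > 0"
    "(k, t) \<in> D \<Longrightarrow> (norm (pd x k t))\<^sup>2 = \<tau> k t * (\<nu> k t)\<^sup>2" for k t
    using assms by (auto simp: isothermic_metric_def)
  show **: "(k, t) \<in> edges D \<Longrightarrow> \<sigma> k t > 0"
    "(k, t) \<in> edges D \<Longrightarrow> (norm (diff x k t))\<^sup>2 = \<sigma> k t * \<nu> k t * \<nu> (k + 1) t"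
    "(k, t) \<in> edges D \<Longrightarrow> (\<sigma> k has_real_derivative 0) (at t)"
    using assms by (auto simp: isothermic_metric_def)
  show "(k, t) \<in> edges D \<Longrightarrow> \<tau> (k + 1) t = \<tau> k t" "continuous_on (slice D k) (\<nu> k)"
    using assms by (auto simp: isothermic_metric_def diff_def[of \<tau>])
  show "(k, t) \<in> D \<Longrightarrow> pd x k t \<noteq> 0"
    using *[of k t] by auto
  show "(k, t) \<in> edges D \<Longrightarrow> diff x k t \<noteq> 0"
    using ** *(1)[of k t] *(1)[of "k+1" t] by (auto simp: edges_def)
qed

text \<open>The two derivatives have lengths \<open>sqrt \<tau> \<nu>\<close> and \<open>sqrt \<tau> \<nu>\<^sub>1\<close>, and a reflection preserves length.\<close>

lemma isothermic_reflect_scale: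
  assumes m: "isothermic_metric D x \<nu> \<sigma> \<tau>" and e: "(k, t) \<in> edges D"
    and "\<mu> > 0" "pd x (k + 1) t = \<mu> *\<^sub>R reflect (diff x k t) (pd x k t)"
  shows "\<mu> = \<nu> (k + 1) t / \<nu> k t"
proof -
  note M = isothermic_metricD[OF m]
  have D: "(k, t) \<in> D" "(k + 1, t) \<in> D" using e by (auto simp: edges_def)
  have "\<tau> k t * (\<nu> (k+1) t)\<^sup>2 = (norm (pd x (k + 1) t))\<^sup>2" using M(3)[OF D(2)] M(7)[OF e] by simp
  also have "\<dots> = \<mu>\<^sup>2 * (norm (pd x k t))\<^sup>2" using assms by (simp add: power_mult_distrib)
  also have "\<dots> = \<mu>\<^sup>2 * (\<tau> k t * (\<nu> k t)\<^sup>2)" using M(3)[OF D(1)] by simp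
  finally have "(\<nu> (k+1) t)\<^sup>2 = (\<mu> * \<nu> k t)\<^sup>2" using M(2)[OF D(1)] by (simp add: power_mult_distrib)
  then have "\<nu> (k+1) t = \<mu> * \<nu> k t"
    by (rule power2_eq_imp_eq) (use M(1)[OF D(1)] M(1)[OF D(2)] \<open>\<mu> > 0\<close> in auto)
  then show ?thesis using M(1)[OF D(1)] by simp
qed

lemma holomorphic_edge_reflect:
  assumes "sd_holomorphic D g \<nu> \<sigma> \<tau>" and e: "(k, t) \<in> edges D"
  shows "pd g (k + 1) t = (\<nu> (k + 1) t / \<nu> k t) *\<^sub>R reflect (diff g k t) (pd g k t)"
proof -
  have m: "isothermic_metric D g \<nu> \<sigma> \<tau>" and c: "planar_circular_edge g k t"
    using assms by (auto simp: sd_holomorphic_def)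
  note M = isothermic_metricD[OF m]
  have D: "(k, t) \<in> D" "(k + 1, t) \<in> D" using e by (auto simp: edges_def)
  obtain \<mu> where "\<mu> > 0" "pd g (k + 1) t = \<mu> *\<^sub>R reflect (diff g k t) (pd g k t)"
    using c planar_arc_iff_reflect[OF M(9)[OF D(1)] M(9)[OF D(2)] M(10)[OF e]]
    unfolding planar_circular_edge_def by blast
  with isothermic_reflect_scale[OF m e this] show ?thesis by simp
qed

section \<open>From holomorphic functions to minimal surfaces\<close>

text \<open>The dual surface is the image of \<open>g\<close> in the unit sphere, and the metric factor of \<open>x\<close> is the
  reciprocal of the metric factor \<open>2 \<nu> / (1 + \<bar>g\<bar>\<^sup>2)\<close> of that image.\<close>

lemma weierstrass_imp_minimal:
  assumes hol: "sd_holomorphic D g \<nu> \<sigma> \<tau>" and W: "weierstrass D g \<sigma> \<tau> x"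
  shows "sd_minimal D x"
proof -
  have sg: "sd_surface D g" and m: "isothermic_metric D g \<nu> \<sigma> \<tau>"
    using hol by (auto simp: sd_holomorphic_def)
  note M = isothermic_metricD[OF m]
  have sx: "sd_surface D x" using W by (simp add: weierstrass_def)
  define y where "y = (\<lambda>k t. inv_stereo (g k t))"
  define N where "N = (\<lambda>k t. stereo_denom (g k t) / (2 * \<nu> k t))"
  define a where "a = (\<lambda>k t. wvec (g k t) (g k t) (cnj (pd g k t)))"
  define d where "d = (\<lambda>k t. wvec (g k t) (g (k + 1) t) (cnj (diff g k t)))"
  have cg: "continuous_on (slice D k) (g k)" "continuous_on (slice D k) (pd g k)" for k
    using sg sd_surface_continuous by (auto simp: sd_surface_def)
  have dy: "(y k has_vector_derivative (2 / (stereo_denom (g k t))\<^sup>2) *\<^sub>R a k t) (at t)" if "(k, t) \<in> D" for k t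
    unfolding y_def a_def
    by (rule has_vector_derivative_inv_stereo sd_surface_has_derivative[OF sg that])+
  have cy: "continuous_on (slice D k) (\<lambda>t. (2 / (stereo_denom (g k t))\<^sup>2) *\<^sub>R a k t)" for k
  proof -
    have "stereo_denom (g k t) \<noteq> 0" for t by simp
    then show ?thesis
      unfolding a_def wvec_def vector3_expand stereo_denom_def
      by (intro continuous_intros cg) auto
  qed
  have sy: "sd_surface D y" "(k, t) \<in> D \<Longrightarrow> pd y k t = (2 / (stereo_denom (g k t))\<^sup>2) *\<^sub>R a k t" for k t
    using sd_surfaceI[of D y "\<lambda>k t. (2 / (stereo_denom (g k t))\<^sup>2) *\<^sub>R a k t"] dy cy by blast+
  have pdx: "pd x k t = - (1 / (2 * (\<nu> k t)\<^sup>2)) *\<^sub>R a k t" if "(k, t) \<in> D" for k t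
    using W that M(1,2,3)[OF that]
    by (auto simp: weierstrass_def weierstrass_wvec wvec_inverse a_def)
  have dx: "diff x k t = (1 / (2 * \<nu> k t * \<nu> (k + 1) t)) *\<^sub>R d k t" if "(k, t) \<in> edges D" for k t
  proof -
    have "diff x k t = (\<sigma> k t / 2) *\<^sub>R wvec (g k t) (g (k + 1) t) (inverse (diff g k t))"
      using W that by (auto simp: weierstrass_def weierstrass_wvec)
    then show ?thesis using M(4,5)[OF that] by (simp add: wvec_inverse d_def)
  qed
  have dfy: "diff y k t = (2 / (stereo_denom (g k t) * stereo_denom (g (k + 1) t))) *\<^sub>R d k t" for k t
    unfolding diff_def[of y] unfolding y_def inv_stereo_diff d_def diff_def[of g] ..
  have na: "(norm (a k t))\<^sup>2 = (stereo_denom (g k t))\<^sup>2 * (\<tau> k t * (\<nu> k t)\<^sup>2)" if "(k, t) \<in> D" for k t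
    unfolding a_def norm_wvec_tangent using M(3)[OF that] by simp
  have nd: "(norm (d k t))\<^sup>2 = stereo_denom (g k t) * stereo_denom (g (k + 1) t) * (\<sigma> k t * \<nu> k t * \<nu> (k + 1) t)"
    if "(k, t) \<in> edges D" for k t
    using M(5)[OF that] unfolding d_def diff_def[of g] norm_wvec_chord by simp
  have Npos: "N k t > 0" if "(k, t) \<in> D" for k t using M(1)[OF that] by (simp add: N_def)
  have edgeD: "(k, t) \<in> D" "(k + 1, t) \<in> D" if "(k, t) \<in> edges D" for k t
    using that by (auto simp: edges_def)
  \<comment> \<open>The reflection law for \<open>g\<close>, transported to the sphere.\<close>
  have refl: "a (k + 1) t = (\<nu> (k + 1) t / \<nu> k t * (stereo_denom (g (k + 1) t) / stereo_denom (g k t))) *\<^sub>R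
      reflect (d k t) (a k t)" if e: "(k, t) \<in> edges D" for k t
  proof -
    have ne: "g (k + 1) t \<noteq> g k t" using M(10)[OF e] by (simp add: diff_def)
    show ?thesis
      unfolding a_def d_def holomorphic_edge_reflect[OF hol e] complex_cnj_scaleR wvec_scaleR
      unfolding diff_def[of g] reflect_wvec[OF ne] by simp
  qed
  \<comment> \<open>Shared by all surfaces with derivatives and edges parallel to \<open>a\<close> and \<open>d\<close>, in particular by \<open>x\<close> and \<open>y\<close>.\<close>
  have reflected: "reflected_edge z k t"
    if e: "(k, t) \<in> edges D" and "\<alpha> \<noteq> 0" "\<gamma> \<noteq> 0" and z: "pd z k t = \<alpha> *\<^sub>R a k t"
       "pd z (k + 1) t = \<beta> *\<^sub>R a (k + 1) t" "diff z k t = \<gamma> *\<^sub>R d k t"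
     for z and \<alpha> \<beta> \<gamma> :: real and k t
    unfolding reflected_edge_def z reflect_scaleR_axis[OF \<open>\<gamma> \<noteq> 0\<close>] reflect_scaleR refl[OF e]
    using \<open>\<alpha> \<noteq> 0\<close>
    by (intro exI[of _ "\<beta> * (\<nu> (k + 1) t / \<nu> k t * (stereo_denom (g (k + 1) t) / stereo_denom (g k t))) / \<alpha>"]) simp
  have rx: "reflected_edge x k t" if e: "(k, t) \<in> edges D" for k t
    by (rule reflected[OF e _ _ pdx pdx dx]) (use edgeD[OF e] M(1)[OF edgeD(1)[OF e]] M(1)[OF edgeD(2)[OF e]] e in auto)
  have ry: "reflected_edge y k t" if e: "(k, t) \<in> edges D" for k t
    by (rule reflected[OF e _ _ sy(2) sy(2) dfy]) (use edgeD[OF e] in auto)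
  have cross: "cross3 (pd x k t) (diff x k t) \<noteq> 0" if e: "(k, t) \<in> edges D" for k t
  proof -
    have "cross3 (a k t) ((2 / (stereo_denom (g k t) * stereo_denom (g (k + 1) t))) *\<^sub>R d k t) \<noteq> 0"
    proof (rule sphere_tangent_not_parallel_chord[of "y k t"])
      show "y k t \<bullet> a k t = 0" by (simp add: y_def a_def inv_stereo_inner_wvec)
      have "y k t + (2 / (stereo_denom (g k t) * stereo_denom (g (k + 1) t))) *\<^sub>R d k t = y (k + 1) t"
        unfolding dfy[symmetric] by (simp add: diff_def)
      then show "norm (y k t + (2 / (stereo_denom (g k t) * stereo_denom (g (k + 1) t))) *\<^sub>R d k t) = norm (y k t)"
        by (simp add: y_def)
      show "a k t \<noteq> 0" using na[OF edgeD(1)[OF e]] M(1,2)[OF edgeD(1)[OF e]] by auto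
      show "(2 / (stereo_denom (g k t) * stereo_denom (g (k + 1) t))) *\<^sub>R d k t \<noteq> 0"
        using nd[OF e] M(1)[OF edgeD(1)[OF e]] M(1)[OF edgeD(2)[OF e]] M(4)[OF e] by auto
    qed
    then show ?thesis
      using M(1)[OF edgeD(1)[OF e]] M(1)[OF edgeD(2)[OF e]]
      unfolding pdx[OF edgeD(1)[OF e]] dx[OF e] by (simp add: cross_mult_left cross_mult_right)
  qed
  have "isothermic_metric D x N \<sigma> \<tau>"
    unfolding isothermic_metric_def
  proof (intro conjI allI ballI; (clarify)?)
    fix k show "continuous_on (slice D k) (N k)"
      unfolding N_def stereo_denom_def using M(1)
      by (intro continuous_intros cg M(8)) (force simp: slice_def)
  next
    fix k t assume D: "(k, t) \<in> D"
    show "0 < N k t \<and> 0 < \<tau> k t \<and> (norm (pd x k t))\<^sup>2 = \<tau> k t * (N k t)\<^sup>2"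
      using Npos[OF D] M(1,2)[OF D] na[OF D]
      by (simp add: pdx[OF D] N_def power_mult_distrib power_divide field_simps)
  next
    fix k t assume e: "(k, t) \<in> edges D"
    show "0 < \<sigma> k t \<and> (norm (diff x k t))\<^sup>2 = \<sigma> k t * N k t * N (k + 1) t \<and>
        (\<sigma> k has_real_derivative 0) (at t) \<and> diff \<tau> k t = 0"
      using M(4,6,7)[OF e] nd[OF e] M(1)[OF edgeD(1)[OF e]] M(1)[OF edgeD(2)[OF e]]
      by (simp add: dx[OF e] N_def power_mult_distrib power_divide diff_def[of \<tau>] field_simps power2_eq_square)
  qed
  then have "isothermic D x N \<sigma> \<tau>"
    using sx circular_if_reflected[OF rx cross] by (simp add: isothermic_def)
  moreover have "dual D N x y"
    unfolding dual_def
  proof (intro conjI sx sy(1) conjugate_if_reflected rx ry; (clarify)?)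
    fix k t assume D: "(k, t) \<in> D"
    show "0 < N k t \<and> pd y k t = - (1 / (N k t)\<^sup>2) *\<^sub>R pd x k t"
      using Npos[OF D] M(1)[OF D] by (simp add: pdx[OF D] sy(2)[OF D] N_def power_mult_distrib power_divide)
  next
    fix k t assume e: "(k, t) \<in> edges D"
    show "diff y k t = (1 / (N k t * N (k + 1) t)) *\<^sub>R diff x k t"
      using M(1)[OF edgeD(1)[OF e]] M(1)[OF edgeD(2)[OF e]] by (simp add: dx[OF e] dfy N_def)
  qed
  moreover have "y k t \<in> sphere 0 1" for k t by (simp add: y_def)
  ultimately have "minimal_with_dual D x y 0 1"
    unfolding minimal_with_dual_def by force
  then show ?thesis unfolding sd_minimal_def by blast
qed

section \<open>Integrability of the Weierstrass equations\<close>

lemma antiderivative_on_open_interval: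
  fixes f :: "real \<Rightarrow> 'a::euclidean_space"
  assumes S: "open S" "is_interval S" and f: "continuous_on S f"
  shows "\<exists>F. \<forall>t\<in>S. (F has_vector_derivative f t) (at t)"
proof (cases "S = {}")
  case False
  define a where "a = Inf (ereal ` S)"
  define b where "b = Sup (ereal ` S)"
  \<comment> \<open>\<open>S\<close> is the open interval from \<open>a\<close> to \<open>b\<close>, possibly unbounded.\<close>
  have ab: "t \<in> S \<longleftrightarrow> a < ereal t \<and> ereal t < b" for t
  proof
    assume t: "t \<in> S"
    then obtain e where e: "e > 0" "cball t e \<subseteq> S" using S(1) open_contains_cball by blast
    then have "t - e \<in> S" "t + e \<in> S" by (auto simp: subset_eq dist_real_def)
    then have "a \<le> ereal (t - e)" "ereal (t + e) \<le> b"
      unfolding a_def b_def by (auto intro: INF_lower SUP_upper)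
    then show "a < ereal t \<and> ereal t < b" using e(1)
      by (meson ereal_less_eq(3) less_add_same_cancel1 diff_less_eq le_less_trans less_ereal.simps(1) less_le_trans)
  next
    assume "a < ereal t \<and> ereal t < b"
    then obtain s u where "s \<in> S" "s < t" "u \<in> S" "t < u"
      unfolding a_def b_def Inf_less_iff less_Sup_iff by auto
    then show "t \<in> S" using S(2) by (meson less_imp_le mem_is_interval_1_I)
  qed
  have "a < b" using False ab by (metis ex_in_conv less_trans)
  moreover have "isCont f t" if "a < ereal t" "ereal t < b" for t
    using f S(1) that ab by (simp add: continuous_on_eq_continuous_at)
  ultimately obtain F where "\<And>t. a < ereal t \<Longrightarrow> ereal t < b \<Longrightarrow> (F has_vector_derivative f t) (at t)"
    using einterval_antiderivative[of a b f] by blast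
  then show ?thesis using ab by blast
qed auto

text \<open>Summation from \<open>0\<close> upwards for \<open>k \<ge> 0\<close>, and downwards for \<open>k < 0\<close>. The constants of integration on the
  slices are chosen with this lemma.\<close>

lemma int_antidifference:
  fixes c :: "int \<Rightarrow> 'a::ab_group_add"
  shows "\<exists>C. \<forall>k. C (k + 1) - C k = c k"
proof (intro exI allI)
  fix k :: int
  let ?C = "\<lambda>k. (\<Sum>i\<in>{0..<k}. c i) - (\<Sum>i\<in>{k..<0}. c i)"
  show "?C (k + 1) - ?C k = c k"
  proof (cases "k \<ge> 0")
    case True
    then have "{0..<k+1} = insert k {0..<k}" "{k+1..<0} = {}" "{k..<0} = {}" by auto
    then show ?thesis by simp
  next
    case False
    then have "{k..<0} = insert k {k+1..<0}" "{0..<k+1} = {}" "{0..<k} = {}" by auto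
    then show ?thesis by simp
  qed
qed

text \<open>Multiplying the reflection law \<open>g\<^sub>1' = - (\<nu>\<^sub>1 / \<nu>) \<Delta>g cnj g' / cnj (\<Delta>g)\<close> by \<open>g'\<close> leaves only squared
  absolute values besides \<open>(\<Delta>g)\<^sup>2\<close>, and these are given by the metric.\<close>

lemma holomorphic_cross_ratio:
  assumes "sd_holomorphic D g \<nu> \<sigma> \<tau>" and e: "(k, t) \<in> edges D"
  shows "pd g k t * pd g (k + 1) t = - of_real (\<tau> k t / \<sigma> k t) * (diff g k t)\<^sup>2"
proof -
  have m: "isothermic_metric D g \<nu> \<sigma> \<tau>" using assms by (auto simp: sd_holomorphic_def)
  note M = isothermic_metricD[OF m]
  have D: "(k, t) \<in> D" "(k + 1, t) \<in> D" using e by (auto simp: edges_def)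
  define a where "a = pd g k t" define d where "d = diff g k t"
  define n where "n = \<nu> k t" define n1 where "n1 = \<nu> (k + 1) t"
  have d: "d \<noteq> 0" using M(10)[OF e] by (simp add: d_def)
  have p: "n > 0" "n1 > 0" "\<sigma> k t > 0" using M(1)[OF D(1)] M(1)[OF D(2)] M(4)[OF e] by (auto simp: n_def n1_def)
  have na: "a * cnj a = of_real (\<tau> k t * n\<^sup>2)"
    using M(3)[OF D(1)] unfolding complex_norm_square[symmetric] a_def n_def by (metis of_real_power)
  have nd: "d * cnj d = of_real (\<sigma> k t * n * n1)"
    using M(5)[OF e] unfolding complex_norm_square[symmetric] d_def n_def n1_def by (metis of_real_power)
  have cd: "cnj d = of_real (\<sigma> k t * n * n1) / d" using nd d by (simp add: field_simps)
  have "a * pd g (k + 1) t = - (of_real (n1 / n) * (a * cnj a) * d / cnj d)"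
    unfolding holomorphic_edge_reflect[OF assms]
    by (simp add: reflect_complex[OF d] a_def[symmetric] d_def[symmetric] n_def[symmetric] n1_def[symmetric] scaleR_conv_of_real)
  also have "\<dots> = - of_real (\<tau> k t / \<sigma> k t) * d\<^sup>2"
    unfolding na cd using p d by (simp add: field_simps power2_eq_square)
  finally show ?thesis by (simp add: a_def d_def)
qed

text \<open>All three components of the Weierstrass vector are of the form \<open>P g h / (h - g)\<close> with a symmetric
  polynomial \<open>P\<close> that is affine in each argument. The derivative then separates into terms that depend on
  one endpoint only, \<open>g' P h h\<close> and \<open>h' P g g\<close>.\<close>

lemma has_vector_derivative_symmetric_quotient:
  fixes g h :: "real \<Rightarrow> complex"
  assumes g: "(g has_vector_derivative g') (at t)" and h: "(h has_vector_derivative h') (at t)"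
    and ne: "h t \<noteq> g t"
  shows "((\<lambda>s. (\<alpha> + \<beta> * (g s + h s) + \<gamma> * (g s * h s)) * inverse (h s - g s)) has_vector_derivative
    (g' * (\<alpha> + \<beta> * (h t + h t) + \<gamma> * (h t * h t)) - h' * (\<alpha> + \<beta> * (g t + g t) + \<gamma> * (g t * g t))) / (h t - g t)\<^sup>2) (at t)"
proof -
  have "((\<lambda>s. h s - g s) has_vector_derivative h' - g') (at t)"
    by (intro has_vector_derivative_diff g h)
  note 1 = this
  have 2: "(inverse has_field_derivative - (inverse (h t - g t) ^ 2)) (at (h t - g t))"
    using ne DERIV_inverse[of "h t - g t"] by (simp add: numeral_2_eq_2)
  have inv: "((\<lambda>s. inverse (h s - g s)) has_vector_derivative (h' - g') * - (inverse (h t - g t) ^ 2)) (at t)"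
    using field_vector_diff_chain_at[OF 1 2] by (simp only: o_def)
  have "h t - g t \<noteq> 0" using ne by simp
  then show ?thesis
    by - (rule has_vector_derivative_eq_rhs, (rule has_vector_derivative_mult has_vector_derivative_add
        has_vector_derivative_const g h inv)+, simp add: divide_simps, simp add: algebra_simps power2_eq_square)
qed

text \<open>By the quotient formula the derivative of \<open>P g g\<^sub>1 / \<Delta>g\<close> is \<open>(g' P g\<^sub>1 g\<^sub>1 - g\<^sub>1' P g g) / (\<Delta>g)\<^sup>2\<close>. Replacing
  \<open>(\<Delta>g)\<^sup>2\<close> by \<open>- (\<sigma> / \<tau>) g' g\<^sub>1'\<close> turns this into \<open>- (\<tau> / \<sigma>) (P g\<^sub>1 g\<^sub>1 / g\<^sub>1' - P g g / g')\<close>.\<close>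

lemma weierstrass_compatibility:
  assumes hol: "sd_holomorphic D g \<nu> \<sigma> \<tau>" and e: "(k, t) \<in> edges D"
  shows "((\<lambda>t. (\<sigma> k t / 2) *\<^sub>R wvec (g k t) (g (k + 1) t) (inverse (diff g k t))) has_vector_derivative
     - (\<tau> (k + 1) t / 2) *\<^sub>R wvec (g (k + 1) t) (g (k + 1) t) (inverse (pd g (k + 1) t))
     - - (\<tau> k t / 2) *\<^sub>R wvec (g k t) (g k t) (inverse (pd g k t))) (at t)"
proof -
  have sg: "sd_surface D g" and m: "isothermic_metric D g \<nu> \<sigma> \<tau>"
    using hol by (auto simp: sd_holomorphic_def)
  note M = isothermic_metricD[OF m]
  have D: "(k, t) \<in> D" "(k + 1, t) \<in> D" using e by (auto simp: edges_def)
  define G where "G = g k" define H where "H = g (k + 1)"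
  define a where "a = pd g k t" define b where "b = pd g (k + 1) t"
  have dG: "(G has_vector_derivative a) (at t)" and dH: "(H has_vector_derivative b) (at t)"
    unfolding G_def H_def a_def b_def by (rule sd_surface_has_derivative[OF sg] D)+
  have ab: "a \<noteq> 0" "b \<noteq> 0" using M(9)[OF D(1)] M(9)[OF D(2)] by (auto simp: a_def b_def)
  have ne: "H t \<noteq> G t" using M(10)[OF e] by (simp add: G_def H_def diff_def)
  define q where "q = (- of_real (\<tau> k t / \<sigma> k t) :: complex)"
  have cr: "a * b = q * (H t - G t)\<^sup>2"
    using holomorphic_cross_ratio[OF hol e] by (simp add: a_def b_def G_def H_def q_def diff_def)
  have Q: "((\<lambda>s. Re ((\<alpha> + \<beta> * (G s + H s) + \<gamma> * (G s * H s)) * inverse (H s - G s))) has_vector_derivative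
    - (\<tau> k t / \<sigma> k t) * (Re ((\<alpha> + \<beta> * (H t + H t) + \<gamma> * (H t * H t)) * inverse b) - Re ((\<alpha> + \<beta> * (G t + G t) + \<gamma> * (G t * G t)) * inverse a))) (at t)"
    for \<alpha> \<beta> \<gamma>
  proof -
    have alg: "(a * X - b * Y) / (H t - G t)\<^sup>2 = q * (X * inverse b - Y * inverse a)" for X Y
    proof -
      have "q * (X * inverse b - Y * inverse a) = q * (a * X - b * Y) / (a * b)"
        using ab by (simp add: field_simps)
      moreover have "q \<noteq> 0" using cr ab by auto
      ultimately show ?thesis unfolding cr by simp
    qed
    have qR: "Re (q * z) = - (\<tau> k t / \<sigma> k t) * Re z" for z by (simp add: q_def)
    from bounded_linear.has_vector_derivative[OF bounded_linear_Re
        has_vector_derivative_symmetric_quotient[OF dG dH ne, of \<alpha> \<beta> \<gamma>]]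
    show ?thesis unfolding alg qR minus_complex.sel .
  qed
  \<comment> \<open>The coefficients \<open>(\<alpha>, \<beta>, \<gamma>)\<close> are \<open>(1, 0, -1)\<close>, \<open>(\<i>, 0, \<i>)\<close> and \<open>(0, 1, 0)\<close>.\<close>
  have E: "(\<sigma> k s / 2) *\<^sub>R wvec (g k s) (g (k + 1) s) (inverse (diff g k s)) =
     (\<sigma> k s / 2) *\<^sub>R (Re ((1 + 0 * (G s + H s) + (-1) * (G s * H s)) * inverse (H s - G s)) *\<^sub>R axis 1 1
      + Re ((\<i> + 0 * (G s + H s) + \<i> * (G s * H s)) * inverse (H s - G s)) *\<^sub>R axis 2 1
      + Re ((0 + 1 * (G s + H s) + 0 * (G s * H s)) * inverse (H s - G s)) *\<^sub>R axis 3 1)" for s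
    by (simp only: wvec_def vector3_expand G_def H_def diff_def) (simp add: distrib_left)
  have "((\<lambda>s. \<sigma> k s / 2) has_real_derivative 0) (at t)"
    using DERIV_cdivide[OF M(6)[OF e], of 2] by simp
  note S = has_vector_derivative_scaleR[OF this]
  show ?thesis
    unfolding E
    apply (rule has_vector_derivative_eq_rhs)
     apply (rule S)
     apply (rule has_vector_derivative_add has_vector_derivative_scaleR[OF _ has_vector_derivative_const]
         Q[unfolded has_real_derivative_iff_has_vector_derivative[symmetric]])+
    using M(4)[OF e]
    unfolding M(7)[OF e] a_def[symmetric] b_def[symmetric] G_def[symmetric] H_def[symmetric] wvec_def vector3_expand
    apply (simp add: vec3_eq_iff axis_def)
    apply (simp add: field_simps)
    done
qed

text \<open>Each slice is integrated separately. On every edge the result misses the difference equation by a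
  constant, because the derivatives agree and the common domain of two slices is connected; shifting
  the slices by suitable constants removes these errors.\<close>

lemma weierstrass_exists:
  assumes "open D" and hol: "sd_holomorphic D g \<nu> \<sigma> \<tau>" and int: "\<forall>k. is_interval (slice D k)"
  shows "\<exists>x. weierstrass D g \<sigma> \<tau> x"
proof -
  have sg: "sd_surface D g" and m: "isothermic_metric D g \<nu> \<sigma> \<tau>"
    using hol by (auto simp: sd_holomorphic_def)
  note M = isothermic_metricD[OF m]
  define R where "R = (\<lambda>k t. - (\<tau> k t / 2) *\<^sub>R wvec (g k t) (g k t) (inverse (pd g k t)))"
  define S where "S = (\<lambda>k t. (\<sigma> k t / 2) *\<^sub>R wvec (g k t) (g (k + 1) t) (inverse (diff g k t)))"
  have cg: "continuous_on (slice D k) (g k)" "continuous_on (slice D k) (pd g k)" for k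
    using sg sd_surface_continuous by (auto simp: sd_surface_def)
  \<comment> \<open>Inserting \<open>\<tau> = \<bar>g'\<bar>\<^sup>2 / \<nu>\<^sup>2\<close> expresses the integrand through continuous functions.\<close>
  have cR: "continuous_on (slice D k) (R k)" for k
  proof -
    have "continuous_on (slice D k) (\<lambda>t. - (1 / (2 * (\<nu> k t)\<^sup>2)) *\<^sub>R wvec (g k t) (g k t) (cnj (pd g k t)))"
      unfolding wvec_def vector3_expand
      using M(1)[of k] by (intro continuous_intros cg M(8)) (force simp: slice_def)
    then show ?thesis
    proof (rule continuous_on_eq)
      fix t assume "t \<in> slice D k"
      then have "(k, t) \<in> D" by (simp add: slice_def)
      then show "- (1 / (2 * (\<nu> k t)\<^sup>2)) *\<^sub>R wvec (g k t) (g k t) (cnj (pd g k t)) = R k t"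
        using M(2,3)[of k t] by (simp add: R_def wvec_inverse)
    qed
  qed
  have "\<exists>F. \<forall>t\<in>slice D k. (F has_vector_derivative R k t) (at t)" for k
    by (rule antiderivative_on_open_interval[OF open_slice[OF \<open>open D\<close>] _ cR]) (use int in blast)
  then obtain F where F: "\<And>k t. (k, t) \<in> D \<Longrightarrow> (F k has_vector_derivative R k t) (at t)"
    unfolding slice_def by (metis mem_Collect_eq)
  have "\<exists>c. \<forall>t. (k, t) \<in> edges D \<longrightarrow> F (k + 1) t - F k t - S k t = c" for k
  proof -
    let ?E = "slice D k \<inter> slice D (k + 1)"
    have E: "t \<in> ?E \<longleftrightarrow> (k, t) \<in> edges D" for t by (auto simp: slice_def edges_def)
    have "convex ?E" using int by (intro convex_Int) (auto simp: is_interval_convex)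
    moreover have "((\<lambda>t. F (k + 1) t - F k t - S k t) has_vector_derivative 0) (at t within ?E)"
      if "t \<in> ?E" for t
    proof -
      from that
      have e: "(k, t) \<in> edges D" unfolding E .
      then have D: "(k, t) \<in> D" "(k + 1, t) \<in> D" by (auto simp: edges_def)
      have "(S k has_vector_derivative R (k + 1) t - R k t) (at t)"
        unfolding R_def S_def by (rule weierstrass_compatibility[OF hol e])
      then have "((\<lambda>t. F (k + 1) t - F k t - S k t) has_vector_derivative
         R (k + 1) t - R k t - (R (k + 1) t - R k t)) (at t)"
        by (intro has_vector_derivative_diff F D)
      then show ?thesis
        by (simp add: has_vector_derivative_at_within)
    qed
    ultimately obtain c where "\<And>t. t \<in> ?E \<Longrightarrow> F (k + 1) t - F k t - S k t = c"
      using has_vector_derivative_zero_constant by blast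
    then show ?thesis unfolding E by blast
  qed
  then obtain c where c: "\<And>k t. (k, t) \<in> edges D \<Longrightarrow> F (k + 1) t - F k t - S k t = c k" by metis
  obtain C where C: "\<And>k. C (k + 1) - C k = - c k" using int_antidifference[of "\<lambda>k. - c k"] by blast
  define x where "x = (\<lambda>k t. F k t + C k)"
  have dx: "(x k has_vector_derivative R k t) (at t)" if "(k, t) \<in> D" for k t
    unfolding x_def using F[OF that] by (auto intro!: derivative_eq_intros)
  have sx: "sd_surface D x" "(k, t) \<in> D \<Longrightarrow> pd x k t = R k t" for k t
    using sd_surfaceI[of D x R] dx cR by blast+
  have "diff x k t = S k t" if "(k, t) \<in> edges D" for k t
  proof -
    have "diff x k t = S k t + (F (k + 1) t - F k t - S k t) + (C (k + 1) - C k)"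
      unfolding diff_def x_def by simp
    then show ?thesis unfolding c[OF that] C by simp
  qed
  then have "weierstrass D g \<sigma> \<tau> x"
    using sx unfolding weierstrass_def weierstrass_wvec R_def S_def by auto
  then show ?thesis by blast
qed

section \<open>From minimal surfaces to holomorphic functions\<close>

text \<open>A dual pair with the second surface in a sphere, expressed through lengths and derivatives only,
  so that it is evidently preserved by isometries.\<close>

definition metric_dual_in_sphere where
  "metric_dual_in_sphere D x y c r \<nu> \<sigma> \<tau> \<longleftrightarrow>
     sd_surface D x \<and> sd_surface D y \<and> isothermic_metric D x \<nu> \<sigma> \<tau> \<and>
     (\<forall>(k, t) \<in> D. pd y k t = - (1 / (\<nu> k t)\<^sup>2) *\<^sub>R pd x k t) \<and>
     (\<forall>(k, t) \<in> edges D. diff y k t = (1 / (\<nu> k t * \<nu> (k + 1) t)) *\<^sub>R diff x k t) \<and>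
     r > 0 \<and> (\<forall>(k, t) \<in> D. y k t \<in> sphere (c::real^3) r)"

lemma metric_dual_in_sphere_if_minimal:
  assumes "minimal_with_dual D x y c r"
  shows "\<exists>\<nu> \<sigma> \<tau>. metric_dual_in_sphere D x y c r \<nu> \<sigma> \<tau>"
  using assms unfolding minimal_with_dual_def isothermic_def dual_def metric_dual_in_sphere_def by fast

lemma sphere_curve_tangent:
  assumes "open D" "sd_surface D y" "(k, t) \<in> D" and sph: "\<And>k t. (k, t) \<in> D \<Longrightarrow> y k t \<in> sphere c r"
  shows "(y k t - c) \<bullet> pd y k t = 0"
proof -
  have "((\<lambda>s. y k s - c) has_derivative (\<lambda>h. h *\<^sub>R pd y k t)) (at t)"
    using sd_surface_has_derivative[OF assms(2,3)] unfolding has_vector_derivative_def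
    by (auto intro!: derivative_eq_intros)
  from has_derivative_inner[OF this this]
  have "((\<lambda>s. (y k s - c) \<bullet> (y k s - c)) has_real_derivative 2 * ((y k t - c) \<bullet> pd y k t)) (at t)"
    unfolding has_field_derivative_def
    by (rule has_derivative_eq_rhs) (auto simp: inner_commute)
  moreover have "((\<lambda>s. (y k s - c) \<bullet> (y k s - c)) has_real_derivative 0) (at t)"
  proof (rule has_field_derivative_transform_within_open[of "\<lambda>s. r\<^sup>2" 0 t "slice D k"])
    fix s assume "s \<in> slice D k"
    then have "norm (y k s - c) = r" using sph[of k s] by (simp add: slice_def dist_norm norm_minus_commute)
    then show "r\<^sup>2 = (y k s - c) \<bullet> (y k s - c)" by (auto simp: power2_norm_eq_inner)
  qed (use assms open_slice in \<open>auto simp: slice_def\<close>)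
  ultimately have "2 * ((y k t - c) \<bullet> pd y k t) = 0" by (rule DERIV_unique)
  then show ?thesis by simp
qed

text \<open>With \<open>\<bar>\<Delta>x\<bar>\<^sup>2 = \<sigma> \<nu> \<nu>\<^sub>1\<close> the dual satisfies \<open>\<Delta>y = \<sigma> \<Delta>x / \<bar>\<Delta>x\<bar>\<^sup>2\<close>, an inversion of \<open>\<Delta>x\<close>. Its derivative is
  known from the derivatives of \<open>y\<close> and also from the derivative of an inversion, and comparing the two
  gives the hypothesis of \<open>reflect_unique\<close> for the vectors \<open>\<partial>x / \<nu>\<close> and \<open>\<partial>x\<^sub>1 / \<nu>\<^sub>1\<close>. If these agree, they
  are tangent to the sphere at both ends of \<open>\<Delta>y\<close>, hence orthogonal to \<open>\<Delta>y\<close>.\<close>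

lemma spherical_dual_edge_reflect:
  assumes "open D" and mds: "metric_dual_in_sphere D x y c r \<nu> \<sigma> \<tau>" and e: "(k, t) \<in> edges D"
  shows "pd x (k + 1) t = (\<nu> (k + 1) t / \<nu> k t) *\<^sub>R reflect (diff x k t) (pd x k t)"
proof -
  have sx: "sd_surface D x" and sy: "sd_surface D y" and m: "isothermic_metric D x \<nu> \<sigma> \<tau>"
    and pdy: "\<And>k t. (k, t) \<in> D \<Longrightarrow> pd y k t = - (1 / (\<nu> k t)\<^sup>2) *\<^sub>R pd x k t"
    and dfy: "\<And>k t. (k, t) \<in> edges D \<Longrightarrow> diff y k t = (1 / (\<nu> k t * \<nu> (k + 1) t)) *\<^sub>R diff x k t"
    and sph: "\<And>k t. (k, t) \<in> D \<Longrightarrow> y k t \<in> sphere c r"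
    using mds unfolding metric_dual_in_sphere_def by fast+
  note M = isothermic_metricD[OF m]
  have D: "(k, t) \<in> D" "(k + 1, t) \<in> D" using e by (auto simp: edges_def)
  define p where "p = \<nu> k t" define q where "q = \<nu> (k + 1) t"
  define d where "d = diff x k t"
  define A where "A = (1 / p) *\<^sub>R pd x k t" define B where "B = (1 / q) *\<^sub>R pd x (k + 1) t"
  have pq: "p > 0" "q > 0" using M(1) D by (auto simp: p_def q_def)
  have d0: "d \<noteq> 0" using M(10)[OF e] by (simp add: d_def)
  have aA: "pd x k t = p *\<^sub>R A" "pd x (k + 1) t = q *\<^sub>R B" using pq by (auto simp: A_def B_def)
  have dpos: "\<sigma> k t * (1 / (d \<bullet> d)) = 1 / (p * q)"
    using M(4,5)[OF e] pq unfolding d_def[symmetric] p_def[symmetric] q_def[symmetric] power2_norm_eq_inner by simp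
  have "((\<lambda>s. diff y k s) has_vector_derivative pd y (k + 1) t - pd y k t) (at t)"
    unfolding diff_def by (intro has_vector_derivative_diff sd_surface_has_derivative[OF sy] D)
  moreover have "((\<lambda>s. diff y k s) has_vector_derivative
      \<sigma> k t *\<^sub>R ((1 / (d \<bullet> d)) *\<^sub>R reflect d (pd x (k + 1) t - pd x k t))) (at t)"
  proof -
    have "((\<lambda>s. diff x k s) has_vector_derivative pd x (k + 1) t - pd x k t) (at t)"
      unfolding diff_def by (intro has_vector_derivative_diff sd_surface_has_derivative[OF sx] D)
    from has_vector_derivative_scaleR[OF M(6)[OF e] has_vector_derivative_inversion[OF this M(10)[OF e]]]
    have "((\<lambda>s. \<sigma> k s *\<^sub>R ((1 / (diff x k s \<bullet> diff x k s)) *\<^sub>R diff x k s)) has_vector_derivative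
      \<sigma> k t *\<^sub>R ((1 / (d \<bullet> d)) *\<^sub>R reflect d (pd x (k + 1) t - pd x k t))) (at t)"
      by (simp add: d_def)
    then show ?thesis
    proof (rule has_vector_derivative_transform_within_open)
      show "open (slice D k \<inter> slice D (k + 1))" "t \<in> slice D k \<inter> slice D (k + 1)"
        using open_slice[OF \<open>open D\<close>] D by (auto simp: slice_def)
      fix s assume "s \<in> slice D k \<inter> slice D (k + 1)"
      then have es: "(k, s) \<in> edges D" "(k, s) \<in> D" "(k + 1, s) \<in> D" by (auto simp: slice_def edges_def)
      have "\<sigma> k s * (1 / (diff x k s \<bullet> diff x k s)) = 1 / (\<nu> k s * \<nu> (k + 1) s)"
        using M(4,5)[OF es(1)] unfolding power2_norm_eq_inner by simp
      then show "\<sigma> k s *\<^sub>R ((1 / (diff x k s \<bullet> diff x k s)) *\<^sub>R diff x k s) = diff y k s"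
        unfolding dfy[OF es(1)] scaleR_scaleR by simp
    qed
  qed
  ultimately have "pd y (k + 1) t - pd y k t = \<sigma> k t *\<^sub>R ((1 / (d \<bullet> d)) *\<^sub>R reflect d (pd x (k + 1) t - pd x k t))"
    by (rule vector_derivative_unique_at)
  then have "(p * q) *\<^sub>R (pd y (k + 1) t - pd y k t) = (p * q) *\<^sub>R ((1 / (p * q)) *\<^sub>R reflect d (pd x (k + 1) t - pd x k t))"
    by (simp only: scaleR_scaleR dpos)
  also have "\<dots> = reflect d (q *\<^sub>R B - p *\<^sub>R A)" using pq by (simp add: aA)
  finally have "(p * q) *\<^sub>R (pd y (k + 1) t - pd y k t) = q *\<^sub>R reflect d B - p *\<^sub>R reflect d A"
    by (simp add: reflect_diff reflect_scaleR)
  moreover have "(p * q) *\<^sub>R (pd y (k + 1) t - pd y k t) = q *\<^sub>R A - p *\<^sub>R B"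
    unfolding pdy[OF D(1)] pdy[OF D(2)] aA p_def[symmetric] q_def[symmetric]
    using pq by (simp add: scaleR_diff_right power2_eq_square)
  ultimately have eq: "q *\<^sub>R reflect d B - p *\<^sub>R reflect d A = q *\<^sub>R A - p *\<^sub>R B" by simp
  have "(norm A)\<^sup>2 = \<tau> k t" "(norm B)\<^sup>2 = \<tau> k t"
    using M(3)[OF D(1)] M(3)[OF D(2)] M(7)[OF e] pq
    unfolding p_def[symmetric] q_def[symmetric] A_def B_def by (simp_all add: power_mult_distrib power_divide)
  then have n: "norm A = norm B" by (metis norm_ge_zero power2_eq_imp_eq)
  have "B = reflect d A"
  proof (rule reflect_unique[OF pq d0 eq n])
    assume AB: "A = B"
    have "(y k t - c) \<bullet> A = 0" "(y (k + 1) t - c) \<bullet> B = 0"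
      using sphere_curve_tangent[OF \<open>open D\<close> sy D(1) sph] sphere_curve_tangent[OF \<open>open D\<close> sy D(2) sph]
      unfolding pdy[OF D(1)] pdy[OF D(2)] A_def B_def p_def q_def using M(1)[OF D(1)] M(1)[OF D(2)] by auto
    then have "diff y k t \<bullet> A = 0" unfolding AB diff_def by (simp add: inner_diff_left)
    then show "A \<bullet> d = 0" using pq unfolding dfy[OF e] p_def[symmetric] q_def[symmetric] d_def[symmetric]
      by (simp add: inner_commute)
  qed
  then have "pd x (k + 1) t = q *\<^sub>R reflect d ((1 / p) *\<^sub>R pd x k t)" by (simp add: aA(2) A_def)
  then show ?thesis by (simp add: reflect_scaleR p_def q_def d_def)
qed

text \<open>The function \<open>g\<close> is the stereographic projection of \<open>(y - c) / r\<close>. Scaling the sphere to radius \<open>1\<close>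
  divides \<open>\<sigma>\<close> and \<open>\<tau>\<close> by \<open>r\<close>, and the metric factor of \<open>g\<close> is \<open>(1 + \<bar>g\<bar>\<^sup>2) / (2 \<nu> sqrt r)\<close>. The reflection law
  for \<open>g\<close> follows from the one for \<open>x\<close> since the derivative of the projection is injective.\<close>

lemma weierstrass_of_spherical_dual:
  assumes "open D" and mds: "metric_dual_in_sphere D x y c r \<nu> \<sigma> \<tau>"
    and pole: "\<forall>(k, t) \<in> D. y k t \<noteq> north_pole c r"
  shows "\<exists>g \<nu> \<sigma> \<tau>. sd_holomorphic_or_straight D g \<nu> \<sigma> \<tau> \<and> weierstrass D g \<sigma> \<tau> x \<and>
           ((\<forall>(k, t) \<in> edges D. \<forall>m n \<rho>. edge_circle y k t m n \<rho> \<longrightarrow> north_pole c r \<notin> circle3 m n \<rho>)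
              \<longrightarrow> sd_holomorphic D g \<nu> \<sigma> \<tau>)"
proof -
  have sx: "sd_surface D x" and sy: "sd_surface D y" and m: "isothermic_metric D x \<nu> \<sigma> \<tau>"
    and pdy: "\<And>k t. (k, t) \<in> D \<Longrightarrow> pd y k t = - (1 / (\<nu> k t)\<^sup>2) *\<^sub>R pd x k t"
    and dfy: "\<And>k t. (k, t) \<in> edges D \<Longrightarrow> diff y k t = (1 / (\<nu> k t * \<nu> (k + 1) t)) *\<^sub>R diff x k t"
    and sph: "\<And>k t. (k, t) \<in> D \<Longrightarrow> y k t \<in> sphere c r" and r: "r > 0"
    using mds unfolding metric_dual_in_sphere_def by fast+
  note M = isothermic_metricD[OF m]
  have edgeD: "(k, t) \<in> D" "(k + 1, t) \<in> D" if "(k, t) \<in> edges D" for k t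
    using that by (auto simp: edges_def)
  define p where "p = (\<lambda>k t. (1 / r) *\<^sub>R (y k t - c))"
  define g where "g = (\<lambda>k t. stereo (p k t))"
  define N where "N = (\<lambda>k t. stereo_denom (g k t) / (2 * \<nu> k t * sqrt r))"
  have yp: "y k t = c + r *\<^sub>R p k t" for k t using r by (simp add: p_def)
  have np: "norm (p k t) = 1" if "(k, t) \<in> D" for k t
    using sph[OF that] r by (simp add: p_def dist_norm norm_minus_commute)
  have p3: "p k t $ 3 < 1" if "(k, t) \<in> D" for k t
    using unit_sphere_north_pole[OF np[OF that]] pole that by (auto simp: north_pole_def yp)
  have pg: "p k t = inv_stereo (g k t)" if "(k, t) \<in> D" for k t
    using inv_stereo_stereo[OF np[OF that] p3[OF that]] by (simp add: g_def)
  have dp: "(p k has_vector_derivative (1 / r) *\<^sub>R pd y k t) (at t)" if "(k, t) \<in> D" for k t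
    unfolding p_def
    by (rule has_vector_derivative_eq_rhs)
       (rule bounded_linear.has_vector_derivative[OF bounded_linear_scaleR_right] has_vector_derivative_diff
         sd_surface_has_derivative[OF sy that] has_vector_derivative_const | simp)+
  define p' where "p' = (\<lambda>k t. (1 / r) *\<^sub>R pd y k t)"
  define g' where "g' = (\<lambda>k t.
    Complex ((p' k t $ 1 * (1 - p k t $ 3) + p k t $ 1 * p' k t $ 3) / (1 - p k t $ 3)\<^sup>2)
            ((p' k t $ 2 * (1 - p k t $ 3) + p k t $ 2 * p' k t $ 3) / (1 - p k t $ 3)\<^sup>2))"
  have cp: "continuous_on (slice D k) (p k)" "continuous_on (slice D k) (p' k)" for k
    using sy sd_surface_continuous[OF sy, of k] unfolding p_def p'_def sd_surface_def
    by (auto intro!: continuous_intros)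
  have dg: "(g k has_vector_derivative g' k t) (at t)" if "(k, t) \<in> D" for k t
    unfolding g_def g'_def p'_def
    by (rule has_vector_derivative_stereo[OF dp[OF that]]) (use p3[OF that] in simp)
  have cg': "continuous_on (slice D k) (g' k)" for k
    unfolding g'_def using p3[of k]
    by (intro continuous_on_Complex continuous_intros cp) (force simp: slice_def)+
  have sg: "sd_surface D g" using sd_surfaceI(1)[of D g g'] dg cg' by blast
  have cg: "continuous_on (slice D k) (g k)" for k by (rule sd_surface_continuous[OF sg])
  define a where "a = (\<lambda>k t. wvec (g k t) (g k t) (cnj (pd g k t)))"
  define d where "d = (\<lambda>k t. wvec (g k t) (g (k + 1) t) (cnj (diff g k t)))"
  have pdya: "pd y k t = (2 * r / (stereo_denom (g k t))\<^sup>2) *\<^sub>R a k t" if D: "(k, t) \<in> D" for k t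
  proof -
    have "((\<lambda>s. inv_stereo (g k s)) has_vector_derivative (2 / (stereo_denom (g k t))\<^sup>2) *\<^sub>R a k t) (at t)"
      unfolding a_def by (rule has_vector_derivative_inv_stereo sd_surface_has_derivative[OF sg D])+
    then have "(p k has_vector_derivative (2 / (stereo_denom (g k t))\<^sup>2) *\<^sub>R a k t) (at t)"
      by (rule has_vector_derivative_transform_within_open[of _ _ _ "slice D k"])
         (use \<open>open D\<close> open_slice D pg in \<open>auto simp: slice_def\<close>)
    from vector_derivative_unique_at[OF dp[OF D] this]
    have "r *\<^sub>R ((1 / r) *\<^sub>R pd y k t) = r *\<^sub>R ((2 / (stereo_denom (g k t))\<^sup>2) *\<^sub>R a k t)" by simp
    then show ?thesis using r by (simp add: mult.commute)
  qed
  have dfyd: "diff y k t = (2 * r / (stereo_denom (g k t) * stereo_denom (g (k + 1) t))) *\<^sub>R d k t"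
    if e: "(k, t) \<in> edges D" for k t
  proof -
    have "diff y k t = r *\<^sub>R (inv_stereo (g (k + 1) t) - inv_stereo (g k t))"
      using pg edgeD[OF e] by (simp add: diff_def yp scaleR_diff_right)
    then show ?thesis by (simp add: inv_stereo_diff d_def diff_def[of g] mult.commute)
  qed
  have pdx: "pd x k t = - ((\<nu> k t)\<^sup>2 * (2 * r / (stereo_denom (g k t))\<^sup>2)) *\<^sub>R a k t" if D: "(k, t) \<in> D" for k t
  proof -
    have "pd x k t = - ((\<nu> k t)\<^sup>2) *\<^sub>R pd y k t" using M(1)[OF D] by (simp add: pdy[OF D])
    then show ?thesis by (simp add: pdya[OF D])
  qed
  have dfx: "diff x k t = (\<nu> k t * \<nu> (k + 1) t * (2 * r / (stereo_denom (g k t) * stereo_denom (g (k + 1) t)))) *\<^sub>R d k t"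
    if e: "(k, t) \<in> edges D" for k t
  proof -
    have "diff x k t = (\<nu> k t * \<nu> (k + 1) t) *\<^sub>R diff y k t"
      using M(1)[OF edgeD(1)[OF e]] M(1)[OF edgeD(2)[OF e]] by (simp add: dfy[OF e])
    then show ?thesis by (simp add: dfyd[OF e])
  qed
  have npdg: "(norm (pd g k t))\<^sup>2 = \<tau> k t / r * (N k t)\<^sup>2" if D: "(k, t) \<in> D" for k t
  proof -
    have "\<tau> k t * (\<nu> k t)\<^sup>2 = ((\<nu> k t)\<^sup>2 * (2 * r / (stereo_denom (g k t))\<^sup>2))\<^sup>2 * ((stereo_denom (g k t))\<^sup>2 * (cmod (pd g k t))\<^sup>2)"
      unfolding M(3)[OF D, symmetric] pdx[OF D] a_def norm_scaleR power_mult_distrib norm_wvec_tangent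
      by (simp only: power2_abs power2_minus power_mult_distrib complex_mod_cnj)
    then show ?thesis using M(1)[OF D] r
      by (simp add: N_def power_mult_distrib power_divide field_simps power2_eq_square)
  qed
  have ndg: "(norm (diff g k t))\<^sup>2 = \<sigma> k t / r * N k t * N (k + 1) t" if e: "(k, t) \<in> edges D" for k t
  proof -
    have nd: "(norm (d k t))\<^sup>2 = stereo_denom (g k t) * stereo_denom (g (k + 1) t) * (cmod (diff g k t))\<^sup>2"
      unfolding d_def diff_def[of g] norm_wvec_chord ..
    have "\<sigma> k t * \<nu> k t * \<nu> (k + 1) t = (\<nu> k t * \<nu> (k + 1) t * (2 * r / (stereo_denom (g k t) * stereo_denom (g (k + 1) t))))\<^sup>2
       * (stereo_denom (g k t) * stereo_denom (g (k + 1) t) * (cmod (diff g k t))\<^sup>2)"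
      unfolding M(5)[OF e, symmetric] dfx[OF e] norm_scaleR power_mult_distrib nd
      by (simp only: power2_abs power_mult_distrib)
    then show ?thesis using M(1)[OF edgeD(1)[OF e]] M(1)[OF edgeD(2)[OF e]] r
      by (simp add: N_def power_mult_distrib power_divide field_simps power2_eq_square)
  qed
  have mg: "isothermic_metric D g N (\<lambda>k t. \<sigma> k t / r) (\<lambda>k t. \<tau> k t / r)"
    unfolding isothermic_metric_def
  proof (intro conjI allI ballI; clarify?)
    fix k show "continuous_on (slice D k) (N k)"
      unfolding N_def stereo_denom_def using M(1)[of k] r
      by (intro continuous_intros cg M(8)) (force simp: slice_def)
  next
    fix k t assume D: "(k, t) \<in> D"
    show "0 < N k t \<and> 0 < \<tau> k t / r \<and> (norm (pd g k t))\<^sup>2 = \<tau> k t / r * (N k t)\<^sup>2"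
      using npdg[OF D] M(1,2)[OF D] r by (simp add: N_def)
  next
    fix k t assume e: "(k, t) \<in> edges D"
    show "0 < \<sigma> k t / r \<and> (norm (diff g k t))\<^sup>2 = \<sigma> k t / r * N k t * N (k + 1) t \<and>
        ((\<lambda>t. \<sigma> k t / r) has_real_derivative 0) (at t) \<and> diff (\<lambda>k t. \<tau> k t / r) k t = 0"
      using ndg[OF e] M(4,7)[OF e] DERIV_cdivide[OF M(6)[OF e], of r] r by (simp add: diff_def[of "\<lambda>k t. _ k t / r"])
  qed
  note Mg = isothermic_metricD[OF mg]
  have refl: "\<exists>\<mu>>0. pd g (k + 1) t = \<mu> *\<^sub>R reflect (diff g k t) (pd g k t)" if e: "(k, t) \<in> edges D" for k t
  proof -
    note D = edgeD[OF e]
    define h where "h = stereo_denom (g k t)" define h1 where "h1 = stereo_denom (g (k + 1) t)"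
    define \<mu> where "\<mu> = \<nu> k t / \<nu> (k + 1) t * (h1 / h)"
    have h: "h > 0" "h1 > 0" by (auto simp: h_def h1_def)
    have n: "\<nu> k t > 0" "\<nu> (k + 1) t > 0" using M(1) D by auto
    have ne: "g (k + 1) t \<noteq> g k t" using Mg(10)[OF e] by (simp add: diff_def)
    have W: "wvec (g (k + 1) t) (g (k + 1) t) (cnj (reflect (diff g k t) (pd g k t))) = (h1 / h) *\<^sub>R reflect (d k t) (a k t)"
      unfolding d_def a_def h_def h1_def diff_def[of g] by (rule reflect_wvec[OF ne])
    have "\<nu> k t * \<nu> (k + 1) t * (2 * r / (h * h1)) \<noteq> 0" using n r h by simp
    then have "reflect (diff x k t) (pd x k t) = - ((\<nu> k t)\<^sup>2 * (2 * r / h\<^sup>2)) *\<^sub>R reflect (d k t) (a k t)"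
      unfolding dfx[OF e] pdx[OF D(1)] reflect_scaleR h_def h1_def by (simp add: reflect_scaleR_axis)
    then have "- ((\<nu> (k + 1) t)\<^sup>2 * (2 * r / h1\<^sup>2)) *\<^sub>R a (k + 1) t =
        (\<nu> (k + 1) t / \<nu> k t) *\<^sub>R (- ((\<nu> k t)\<^sup>2 * (2 * r / h\<^sup>2)) *\<^sub>R reflect (d k t) (a k t))"
      using spherical_dual_edge_reflect[OF \<open>open D\<close> mds e] pdx[OF D(2)] by (simp add: h1_def)
    then have "(- (h1\<^sup>2 / (2 * r * (\<nu> (k + 1) t)\<^sup>2))) *\<^sub>R (- ((\<nu> (k + 1) t)\<^sup>2 * (2 * r / h1\<^sup>2)) *\<^sub>R a (k + 1) t) =
        (- (h1\<^sup>2 / (2 * r * (\<nu> (k + 1) t)\<^sup>2))) *\<^sub>R ((\<nu> (k + 1) t / \<nu> k t) *\<^sub>R (- ((\<nu> k t)\<^sup>2 * (2 * r / h\<^sup>2)) *\<^sub>R reflect (d k t) (a k t)))"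
      by simp
    then have "a (k + 1) t = \<mu> *\<^sub>R ((h1 / h) *\<^sub>R reflect (d k t) (a k t))"
      using n h r by (simp add: \<mu>_def power2_eq_square mult_ac)
    \<comment> \<open>By the intertwining property, \<open>\<partial>g\<^sub>1\<close> and the multiple of the reflected \<open>\<partial>g\<close> have the same image.\<close>
    then have "wvec (g (k + 1) t) (g (k + 1) t) (cnj (pd g (k + 1) t - \<mu> *\<^sub>R reflect (diff g k t) (pd g k t))) = 0"
      unfolding W[symmetric] complex_cnj_diff wvec_diff complex_cnj_scaleR wvec_scaleR by (simp add: a_def)
    moreover have "\<mu> > 0" using n h by (simp add: \<mu>_def)
    ultimately show ?thesis unfolding wvec_zero_iff by auto
  qed
  have edge: "planar_circular_edge g k t \<longleftrightarrow> Im (pd g k t / diff g k t) \<noteq> 0" if e: "(k, t) \<in> edges D" for k t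
    using planar_arc_iff_reflect[OF Mg(9)[OF edgeD(1)[OF e]] Mg(9)[OF edgeD(2)[OF e]] Mg(10)[OF e]] refl[OF e]
    unfolding planar_circular_edge_def by blast
  have straight: "planar_straight_edge g k t"
    if e: "(k, t) \<in> edges D" and "\<not> planar_circular_edge g k t" for k t
    using planar_straight_if_reflect[OF Mg(9)[OF edgeD(1)[OF e]] Mg(10)[OF e]] refl[OF e] that edge[OF e]
    unfolding planar_straight_edge_def by blast
  have hs: "sd_holomorphic_or_straight D g N (\<lambda>k t. \<sigma> k t / r) (\<lambda>k t. \<tau> k t / r)"
    unfolding sd_holomorphic_or_straight_def using sg mg straight by auto
  have W: "weierstrass D g (\<lambda>k t. \<sigma> k t / r) (\<lambda>k t. \<tau> k t / r) x"
    unfolding weierstrass_def weierstrass_wvec wvec_inverse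
  proof (intro conjI sx; clarify)
    fix k t assume D: "(k, t) \<in> D"
    show "pd x k t = - (\<tau> k t / r / 2) *\<^sub>R (1 / (cmod (pd g k t))\<^sup>2) *\<^sub>R wvec (g k t) (g k t) (cnj (pd g k t))"
      unfolding npdg[OF D] pdx[OF D] a_def N_def using r M(1,2)[OF D]
      by (simp add: power_mult_distrib power_divide mult_ac)
  next
    fix k t assume e: "(k, t) \<in> edges D"
    show "diff x k t = (\<sigma> k t / r / 2) *\<^sub>R (1 / (cmod (diff g k t))\<^sup>2) *\<^sub>R wvec (g k t) (g (k + 1) t) (cnj (diff g k t))"
      unfolding ndg[OF e] dfx[OF e] d_def N_def
      using r M(1)[OF edgeD(1)[OF e]] M(1)[OF edgeD(2)[OF e]] M(4)[OF e]
      by (simp add: field_simps)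
  qed
  \<comment> \<open>If \<open>\<partial>g\<close> is parallel to \<open>\<Delta>g\<close>, the line through \<open>g\<close> and \<open>g\<^sub>1\<close> becomes a circle through the pole.\<close>
  have pole_circle: "\<exists>m n \<rho>. edge_circle y k t m n \<rho> \<and> north_pole c r \<in> circle3 m n \<rho>"
    if e: "(k, t) \<in> edges D" and nc: "\<not> planar_circular_edge g k t" for k t
  proof -
    note D = edgeD[OF e]
    define v where "v = pd g k t" define w where "w = diff g k t"
    define z where "z = g k t" define z1 where "z1 = g (k + 1) t"
    define n where "n = line_normal v z"
    define h where "h = r * (Re v * Im z - Im v * Re z)"
    have vw: "v \<noteq> 0" "w \<noteq> 0" using Mg(9)[OF D(1)] Mg(10)[OF e] by (auto simp: v_def w_def)
    have "Im (v / w) = 0" using nc edge[OF e] by (simp add: v_def w_def)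
    then have q: "v = of_real (Re (v / w)) * w" using vw
      by (metis complex_is_Real_iff nonzero_eq_divide_eq of_real_Re)
    have "Re v = Re (v / w) * Re w" "Im v = Re (v / w) * Im w" by (subst q, simp)+
    then have par: "Im v * Re w = Re v * Im w" by simp
    have z1: "z1 = z + w" by (simp add: z1_def z_def w_def diff_def)
    have h1: "Re v * Im z1 - Im v * Re z1 = Re v * Im z - Im v * Re z"
      using par by (simp add: z1 algebra_simps)
    have n1: "n = line_normal v z1" unfolding n_def line_normal_def h1 ..
    obtain \<mu> where "pd g (k + 1) t = \<mu> *\<^sub>R reflect w v" using refl[OF e] by (auto simp: v_def w_def)
    moreover have "reflect w v = - v"
      using vw by (subst (1 2) q) (simp add: reflect_complex)
    ultimately have v1: "pd g (k + 1) t = (- \<mu>) *\<^sub>R v" by simp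
    have n0: "n \<noteq> 0" using vw by (auto simp: n_def line_normal_def vec3_eq_iff complex_eq_iff)
    have "n \<bullet> (y k t - c) = h" "n \<bullet> (y (k + 1) t - c) = h"
      unfolding yp pg[OF D(1)] pg[OF D(2)] n_def n1[unfolded n_def] z_def[symmetric] z1_def[symmetric] h_def
      using line_normal_inv_stereo[of v z] line_normal_inv_stereo[of v z1] h1 by (simp_all add: n1[unfolded n_def, symmetric])
    moreover have "n \<bullet> (north_pole c r - c) = h"
      by (simp add: north_pole_def n_def line_normal_def inner_vec3 h_def)
    moreover have "north_pole c r \<in> sphere c r"
    proof -
      have "norm (vector [0, 0, 1] :: real^3) = 1"
        by (simp add: norm_eq_sqrt_inner inner_vec3)
      then show ?thesis using r by (simp add: north_pole_def dist_norm)
    qed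
    moreover have "y k t \<noteq> north_pole c r" using pole D by auto
    moreover note sph[OF D(1)] n0
    ultimately obtain m \<rho> where m: "\<rho> > 0" "north_pole c r \<in> circle3 m n \<rho>"
      "\<And>z v. z \<in> sphere c r \<Longrightarrow> n \<bullet> (z - c) = h \<Longrightarrow> (z - c) \<bullet> v = 0 \<Longrightarrow> n \<bullet> v = 0 \<Longrightarrow>
         tangent_to_circle3 m n \<rho> z v"
      and hy: "n \<bullet> (y k t - c) = h" "n \<bullet> (y (k + 1) t - c) = h"
      using plane_section_of_sphere[of n "north_pole c r" c r "y k t" h] by metis
    have "n \<bullet> pd y k t = 0"
      unfolding pdya[OF D(1)] a_def n_def z_def[symmetric] v_def[symmetric] by (simp add: line_normal_tangent)
    moreover have "n \<bullet> pd y (k + 1) t = 0"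
    proof -
      show ?thesis
        unfolding pdya[OF D(2)] a_def n1 z1_def[symmetric] v1 complex_cnj_scaleR wvec_scaleR
        by (simp only: inner_scaleR_right line_normal_tangent mult_zero_right)
    qed
    ultimately have "edge_circle y k t m n \<rho>"
      unfolding edge_circle_def using m(1,3) n0 hy sph D sphere_curve_tangent[OF \<open>open D\<close> sy _ sph] by blast
    then show ?thesis using m(2) by blast
  qed
  show ?thesis
    apply (rule exI[of _ g], rule exI[of _ N], rule exI[of _ "\<lambda>k t. \<sigma> k t / r"], rule exI[of _ "\<lambda>k t. \<tau> k t / r"])
    using hs W pole_circle sg mg unfolding sd_holomorphic_def by blast
qed

section \<open>Rotating the dual surface away from the north pole\<close>

text \<open>The cone over a differentiable curve is the image of a differentiable map from the plane into space,
  hence a null set, and countably many null sets do not cover the space.\<close>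

lemma cone_over_curves_not_everything:
  fixes f :: "int \<Rightarrow> real \<Rightarrow> real^3"
  assumes "\<And>k t. (k, t) \<in> D \<Longrightarrow> f k differentiable (at t)"
  shows "\<exists>v. v \<noteq> 0 \<and> (\<forall>(k, t) \<in> D. \<forall>s. v \<noteq> s *\<^sub>R f k t)"
proof -
  define C where "C = (\<lambda>k. (\<lambda>p::real\<times>real. fst p *\<^sub>R f k (snd p)) ` (UNIV \<times> slice D k))"
  have "negligible (C k)" for k
    unfolding C_def
  proof (rule negligible_differentiable_image_lowdim)
    show "DIM(real \<times> real) < DIM(real^3)" by simp
    show "(\<lambda>p::real\<times>real. fst p *\<^sub>R f k (snd p)) differentiable_on UNIV \<times> slice D k"
      unfolding differentiable_on_def
    proof
      fix p :: "real \<times> real" assume "p \<in> UNIV \<times> slice D k"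
      then have "f k differentiable (at (snd p))" using assms by (auto simp: slice_def)
      then obtain f' where f': "(f k has_derivative f') (at (snd p))" by (auto simp: differentiable_def)
      have "((\<lambda>q. f k (snd q)) has_derivative (\<lambda>h. f' (snd h))) (at p within UNIV \<times> slice D k)"
        using has_derivative_compose[OF has_derivative_snd[OF has_derivative_ident] f', of "UNIV \<times> slice D k"] by simp
      from has_derivative_scaleR[OF has_derivative_fst[OF has_derivative_ident] this]
      show "(\<lambda>p::real\<times>real. fst p *\<^sub>R f k (snd p)) differentiable at p within UNIV \<times> slice D k"
        by (auto simp: differentiable_def)
    qed
  qed
  \<comment> \<open>The origin is added in order to obtain a nonzero vector even if \<open>D\<close> is empty.\<close>
  then have "negligible (insert 0 (\<Union>k. C k))"
    by (auto intro!: negligible_countable_Union)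
  then obtain v where v: "v \<notin> insert 0 (\<Union>k. C k)"
    using non_negligible_UNIV by (metis UNIV_eq_I)
  have "v \<noteq> s *\<^sub>R f k t" if "(k, t) \<in> D" for k t s
  proof
    assume "v = s *\<^sub>R f k t"
    then have "v \<in> C k" unfolding C_def using that by (intro image_eqI[of _ _ "(s, t)"]) (auto simp: slice_def)
    then show False using v by auto
  qed
  then show ?thesis using v by auto
qed

lemma bounded_linear_surface:
  fixes f :: "'a::real_normed_vector \<Rightarrow> 'b::real_normed_vector"
  assumes f: "bounded_linear f"
    and sx: "sd_surface D x"
  shows "sd_surface D (\<lambda>k t. f (x k t))" "(k, t) \<in> D \<Longrightarrow> pd (\<lambda>k t. f (x k t)) k t = f (pd x k t)"
proof -
  have "((\<lambda>t. f (x k t)) has_vector_derivative f (pd x k t)) (at t)" if "(k, t) \<in> D" for k t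
    by (rule bounded_linear.has_vector_derivative[OF f sd_surface_has_derivative[OF sx that]])
  moreover have "continuous_on (slice D k) (\<lambda>t. f (pd x k t))" for k
    using sx unfolding sd_surface_def by (auto intro: bounded_linear.continuous_on[OF f])
  ultimately show "sd_surface D (\<lambda>k t. f (x k t))" "(k, t) \<in> D \<Longrightarrow> pd (\<lambda>k t. f (x k t)) k t = f (pd x k t)"
    using sd_surfaceI[of D "\<lambda>k t. f (x k t)" "\<lambda>k t. f (pd x k t)"] by blast+
qed

lemma isometry_metric_dual_in_sphere:
  fixes f :: "real^3 \<Rightarrow> real^3"
  assumes f: "orthogonal_transformation f" and mds: "metric_dual_in_sphere D x y c r \<nu> \<sigma> \<tau>"
  shows "metric_dual_in_sphere D (\<lambda>k t. f (x k t)) (\<lambda>k t. f (y k t)) (f c) r \<nu> \<sigma> \<tau>"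
proof -
  have lf: "linear f" using f by (rule orthogonal_transformation_linear)
  then have bf: "bounded_linear f" by (rule linear_conv_bounded_linear[THEN iffD1])
  have nf: "norm (f v) = norm v" for v using f by (rule orthogonal_transformation_norm)
  have df: "diff (\<lambda>k t. f (z k t)) k t = f (diff z k t)" for z k t
    by (simp add: diff_def linear_diff[OF lf])
  have sx: "sd_surface D x" and sy: "sd_surface D y" using mds by (auto simp: metric_dual_in_sphere_def)
  note F = bounded_linear_surface[OF bf sx] bounded_linear_surface[OF bf sy]
  have dist: "dist (f v) (f w) = dist v w" for v w by (simp add: dist_norm linear_diff[OF lf, symmetric] nf)
  have "isothermic_metric D (\<lambda>k t. f (x k t)) \<nu> \<sigma> \<tau>"
    using mds unfolding metric_dual_in_sphere_def isothermic_metric_def df nf by (auto simp: F(2) nf)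
  then show ?thesis
    using mds F(1,3) unfolding metric_dual_in_sphere_def df
    by (auto simp: F(2,4) linear_cmul[OF lf] dist linear_neg[OF lf])
qed

text \<open>A vector \<open>v\<close> outside the cone with vertex \<open>c\<close> over the dual surface is the direction of a point of
  the sphere that the dual surface misses; it is rotated to the axis of projection.\<close>

lemma weierstrass_after_rotation:
  assumes "open D" and min: "sd_minimal D x"
  shows "\<exists>R g \<nu> \<sigma> \<tau>. rotation_matrix R \<and> sd_holomorphic_or_straight D g \<nu> \<sigma> \<tau> \<and>
           weierstrass D g \<sigma> \<tau> (\<lambda>k t. R *v x k t)"
proof -
  obtain y c r \<nu> \<sigma> \<tau> where mds: "metric_dual_in_sphere D x y c r \<nu> \<sigma> \<tau>"
    using min metric_dual_in_sphere_if_minimal unfolding sd_minimal_def by metis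
  then have r: "r > 0" and sy: "sd_surface D y" by (auto simp: metric_dual_in_sphere_def)
  have "(\<lambda>t. y k t - c) differentiable (at t)" if "(k, t) \<in> D" for k t
    using sy that unfolding sd_surface_def by (auto intro!: differentiable_diff)
  then obtain v where v: "v \<noteq> 0" "\<And>k t s. (k, t) \<in> D \<Longrightarrow> v \<noteq> s *\<^sub>R (y k t - c)"
    using cone_over_curves_not_everything[of D "\<lambda>k t. y k t - c"] by fast
  define u where "u = (1 / norm v) *\<^sub>R v"
  have "norm u = norm (vector [0, 0, 1] :: real^3)"
    using v(1) by (simp add: u_def norm_eq_sqrt_inner[of "vector _"] inner_vec3)
  then obtain f where f: "orthogonal_transformation f" "det (matrix f) = 1" "f u = vector [0, 0, 1]"
    using rotation_exists[of u "vector [0, 0, 1]"] by auto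
  have lf: "linear f" using f(1) by (rule orthogonal_transformation_linear)
  define R where "R = matrix f"
  have Rf: "R *v w = f w" for w using lf by (simp add: R_def matrix_works)
  have rot: "rotation_matrix R"
    using f(1,2) orthogonal_transformation_matrix[of f] by (simp add: rotation_matrix_def R_def)
  have "f (y k t) \<noteq> north_pole (f c) r" if "(k, t) \<in> D" for k t
  proof
    assume "f (y k t) = north_pole (f c) r"
    then have "f (y k t) = f (c + r *\<^sub>R u)"
      by (simp add: north_pole_def f(3) linear_add[OF lf] linear_cmul[OF lf])
    then have "y k t = c + r *\<^sub>R u" using orthogonal_transformation_inj[OF f(1)] by (simp add: inj_eq)
    then have "v = (norm v / r) *\<^sub>R (y k t - c)" using r v(1) by (simp add: u_def)
    then show False using v(2)[OF that] by blast
  qed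
  then have "\<forall>(k, t) \<in> D. f (y k t) \<noteq> north_pole (f c) r" by auto
  from weierstrass_of_spherical_dual[OF \<open>open D\<close> isometry_metric_dual_in_sphere[OF f(1) mds] this]
  have "\<exists>g \<nu> \<sigma> \<tau>. sd_holomorphic_or_straight D g \<nu> \<sigma> \<tau> \<and> weierstrass D g \<sigma> \<tau> (\<lambda>k t. R *v x k t)"
    unfolding Rf by blast
  then show ?thesis using rot by blast
qed

theorem theorem4:
  fixes D :: "(int \<times> real) set"
  assumes "open D"
  shows
    "(\<forall>g \<nu> \<sigma> \<tau>. sd_holomorphic D g \<nu> \<sigma> \<tau> \<longrightarrow>
        (\<forall>x. weierstrass D g \<sigma> \<tau> x \<longrightarrow> sd_minimal D x) \<and>
        ((\<forall>k. is_interval (slice D k)) \<longrightarrow> (\<exists>x. weierstrass D g \<sigma> \<tau> x))) \<and>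
     (\<forall>x y c r. minimal_with_dual D x y c r \<and> (\<forall>(k, t) \<in> D. y k t \<noteq> north_pole c r) \<longrightarrow>
        (\<exists>g \<nu> \<sigma> \<tau>. sd_holomorphic_or_straight D g \<nu> \<sigma> \<tau> \<and> weierstrass D g \<sigma> \<tau> x \<and>
           ((\<forall>(k, t) \<in> edges D. \<forall>m n \<rho>. edge_circle y k t m n \<rho> \<longrightarrow> north_pole c r \<notin> circle3 m n \<rho>)
              \<longrightarrow> sd_holomorphic D g \<nu> \<sigma> \<tau>))) \<and>
     (\<forall>x. sd_minimal D x \<longrightarrow>
        (\<exists>R g \<nu> \<sigma> \<tau>. rotation_matrix R \<and> sd_holomorphic_or_straight D g \<nu> \<sigma> \<tau> \<and>
           weierstrass D g \<sigma> \<tau> (\<lambda>k t. R *v x k t)))"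
proof (intro conjI allI impI; (elim conjE)?)
  fix g \<nu> \<sigma> \<tau> x assume "sd_holomorphic D g \<nu> \<sigma> \<tau>" "weierstrass D g \<sigma> \<tau> x"
  then show "sd_minimal D x" by (rule weierstrass_imp_minimal)
next
  fix g \<nu> \<sigma> \<tau> assume "sd_holomorphic D g \<nu> \<sigma> \<tau>" "\<forall>k. is_interval (slice D k)"
  then show "\<exists>x. weierstrass D g \<sigma> \<tau> x" by (rule weierstrass_exists[OF assms])
next
  fix x y c r
  assume "minimal_with_dual D x y c r" and pole: "\<forall>(k, t) \<in> D. y k t \<noteq> north_pole c r"
  then obtain \<nu> \<sigma> \<tau> where "metric_dual_in_sphere D x y c r \<nu> \<sigma> \<tau>"
    using metric_dual_in_sphere_if_minimal by blast
  from weierstrass_of_spherical_dual[OF assms this pole]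
  show "\<exists>g \<nu> \<sigma> \<tau>. sd_holomorphic_or_straight D g \<nu> \<sigma> \<tau> \<and> weierstrass D g \<sigma> \<tau> x \<and>
     ((\<forall>(k, t) \<in> edges D. \<forall>m n \<rho>. edge_circle y k t m n \<rho> \<longrightarrow> north_pole c r \<notin> circle3 m n \<rho>)
        \<longrightarrow> sd_holomorphic D g \<nu> \<sigma> \<tau>)" .
next
  fix x assume "sd_minimal D x"
  then show "\<exists>R g \<nu> \<sigma> \<tau>. rotation_matrix R \<and> sd_holomorphic_or_straight D g \<nu> \<sigma> \<tau> \<and>
     weierstrass D g \<sigma> \<tau> (\<lambda>k t. R *v x k t)"
    by (rule weierstrass_after_rotation[OF assms])
qed

end
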